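(* Let $m\ge 1$ be an integer, and set $$R=\{\rho_0^2,\ \rho_1^2,\ \rho_2^2,\ (\rho_0\rho_1)^6,\ (\rho_1\rho_2)^6,\ (\rho_0\rho_2)^2,\ (\rho_2\rho_1\rho_0\rho_1)^3\},$$ $$R_1=\{((\rho_0\rho_2\rho_1)^{4m})^{\rho_1},\ (\rho_2\rho_1\rho_0)^{4m},\ ((\rho_2\rho_1\rho_0)^{4m})^{\rho_1}\},$$ $$R_2=\{(((\rho_1\rho_2)^3(\rho_0\rho_1)^3)^{2m})^{\rho_0\rho_1},\ (((\rho_1\rho_2)^3(\rho_0\rho_1)^3)^{2m})^{\rho_2},\ (((\rho_1\rho_2)^3(\rho_0\rho_1)^3)^{2m})^{\rho_2\rho_1}\},$$ $$R_3=\{(((\rho_0\rho_1)^2(\rho_2\rho_1)^2)^{3m})^{\rho_0},\ ((\rho_1\rho_2)^2(\rho_1\rho_0)^2)^{3m},\ (((\rho_1\rho_0)^2(\rho_1\rho_2)^2)^{3m})^{\rho_2}\}.$$ Define the finitely presented groups $$G_m=\langle \rho_0,\rho_1,\rho_2\mid R,R_1\rangle,\quad H_m=\langle \rho_0,\rho_1,\rho_2\mid R,R_2\rangle,\quad I_m=\langle \rho_0,\rho_1,\rho_2\mid R,R_3\rangle.$$ Then $(G_m,\{\rho_0,\rho_1,\rho_2\})$, $(H_m,\{\rho_0,\rho_1,\rho_2\})$ and $(I_m,\{\rho_0,\rho_1,\rho_2\})$ are string C-groups of type $\{6,6\}$, with solvable underlying groups, of orders $192m^3$, $384m^3$ and $768m^3$,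 respectively.
   Context: Conjugation is written $g^h=h^{-1}gh$. A string C-group of rank $3$ is a pair $(G,\{\rho_0,\rho_1,\rho_2\})$ where $G$ is a group generated by the ordered set of involutions $\rho_0,\rho_1,\rho_2$ such that $\rho_0\rho_2=\rho_2\rho_0$ (string property) and, writing $G_I=\langle \rho_i : i\in I\rangle$, one has $G_I\cap G_J=G_{I\cap J}$ for all $I,J\subseteq\{0,1,2\}$ (intersection property). Its order is $|G|$ and its (Schläfli) type is $\{o(\rho_0\rho_1),o(\rho_1\rho_2)\}$, an ordered pair, where $o(g)$ denotes the order of $g$. *)

theory Defs
  imports "HOL-Algebra.Multiplicative_Group" "HOL-Algebra.Solvable_Groups"
begin

section \<open>Group presentations\<close>

text \<open>
  A word over an alphabet is a list of signed letters: \<open>(x, True)\<close> stands for \<open>x\<close> and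
  \<open>(x, False)\<close> for the formal inverse of \<open>x\<close>.
\<close>

type_synonym 'a word = "('a \<times> bool) list"

definition words :: "'a set \<Rightarrow> 'a word set" where
  "words X = lists (X \<times> UNIV)"

definition winv :: "'a word \<Rightarrow> 'a word" where
  "winv w = rev (map (\<lambda>(x, b). (x, \<not> b)) w)"

definition wpow :: "'a word \<Rightarrow> nat \<Rightarrow> 'a word" (infixl \<open>\<up>\<close> 80) where
  "w \<up> n = concat (replicate n w)"

text \<open>\<open>wconj g h\<close> is the conjugate of \<open>g\<close> by \<open>h\<close> in the convention where it equals
  the product of the inverse of \<open>h\<close>, of \<open>g\<close> and of \<open>h\<close>.\<close>

definition wconj :: "'a word \<Rightarrow> 'a word \<Rightarrow> 'a word" where
  "wconj g h = winv h @ g @ h"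

text \<open>
  The least congruence on the monoid of words over \<open>X\<close> that cancels adjacent inverse letters
  and trivialises every relator in \<open>R\<close>. Elements of \<open>R\<close> that are not words over \<open>X\<close> play no role.
\<close>

inductive pres_eq :: "'a set \<Rightarrow> 'a word set \<Rightarrow> 'a word \<Rightarrow> 'a word \<Rightarrow> bool"
  for X :: "'a set" and R :: "'a word set" where
  refl: "u \<in> words X \<Longrightarrow> pres_eq X R u u"
| sym: "pres_eq X R u v \<Longrightarrow> pres_eq X R v u"
| trans: "pres_eq X R u v \<Longrightarrow> pres_eq X R v w \<Longrightarrow> pres_eq X R u w"
| append: "pres_eq X R u u' \<Longrightarrow> pres_eq X R v v' \<Longrightarrow> pres_eq X R (u @ v) (u' @ v')"
| cancel: "x \<in> X \<Longrightarrow> pres_eq X R [(x, b), (x, \<not> b)] []"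
| relator: "r \<in> R \<Longrightarrow> r \<in> words X \<Longrightarrow> pres_eq X R r []"

definition pres_rel :: "'a set \<Rightarrow> 'a word set \<Rightarrow> ('a word \<times> 'a word) set" where
  "pres_rel X R = {(u, v). pres_eq X R u v}"

definition presented_group :: "'a set \<Rightarrow> 'a word set \<Rightarrow> 'a word set monoid" where
  "presented_group X R =
     \<lparr>carrier = words X // pres_rel X R,
      mult = (\<lambda>A B. \<Union>u\<in>A. \<Union>v\<in>B. pres_rel X R `` {u @ v}),
      one = pres_rel X R `` {[]}\<rparr>"

definition pres_gen :: "'a set \<Rightarrow> 'a word set \<Rightarrow> 'a \<Rightarrow> 'a word set" where
  "pres_gen X R x = pres_rel X R `` {[(x, True)]}"

lemma words_Nil [simp]: "[] \<in> words X"
  and words_append [simp]: "u @ v \<in> words X \<longleftrightarrow> u \<in> words X \<and> v \<in> words X"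
  and words_Cons [simp]: "(x, b) # u \<in> words X \<longleftrightarrow> x \<in> X \<and> u \<in> words X"
  by (auto simp: words_def)

lemma pres_eq_words: "pres_eq X R u v \<Longrightarrow> u \<in> words X \<and> v \<in> words X"
  by (induction rule: pres_eq.induct) auto

lemma equiv_pres_rel: "equiv (words X) (pres_rel X R)"
  by (rule equivI)
    (auto simp: pres_rel_def refl_on_def sym_def trans_def
          dest: pres_eq_words intro: pres_eq.intros)

lemma pres_class_eq_iff:
  assumes "u \<in> words X" "v \<in> words X"
  shows "pres_rel X R `` {u} = pres_rel X R `` {v} \<longleftrightarrow> pres_eq X R u v"
  using eq_equiv_class_iff[OF equiv_pres_rel assms, of R] by (simp add: pres_rel_def)

lemma pres_carrierE:
  assumes "A \<in> carrier (presented_group X R)"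
  obtains u where "u \<in> words X" "A = pres_rel X R `` {u}"
  using assms by (auto simp: presented_group_def elim: quotientE)

lemma pres_class_carrier [simp]:
  "u \<in> words X \<Longrightarrow> pres_rel X R `` {u} \<in> carrier (presented_group X R)"
  by (auto simp: presented_group_def intro: quotientI)

lemma pres_class_mult [simp]:
  assumes "u \<in> words X" "v \<in> words X"
  shows "pres_rel X R `` {u} \<otimes>\<^bsub>presented_group X R\<^esub> pres_rel X R `` {v}
         = pres_rel X R `` {u @ v}"
proof -
  have *: "pres_rel X R `` {u' @ v'} = pres_rel X R `` {u @ v}"
    if "u' \<in> pres_rel X R `` {u}" "v' \<in> pres_rel X R `` {v}" for u' v'
  proof -
    have "pres_eq X R (u' @ v') (u @ v)"
      using that by (auto simp: pres_rel_def intro: pres_eq.append pres_eq.sym)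
    then show ?thesis
      using pres_class_eq_iff pres_eq_words by metis
  qed
  have u_v: "u \<in> pres_rel X R `` {u}" "v \<in> pres_rel X R `` {v}"
    using assms by (auto simp: pres_rel_def intro: pres_eq.refl)
  have "(\<Union>u'\<in>pres_rel X R `` {u}. \<Union>v'\<in>pres_rel X R `` {v}. pres_rel X R `` {u' @ v'})
             = (\<Union>u'\<in>pres_rel X R `` {u}. \<Union>v'\<in>pres_rel X R `` {v}. pres_rel X R `` {u @ v})"
    by (intro SUP_cong HOL.refl *)
  also have "\<dots> = pres_rel X R `` {u @ v}"
    using u_v by blast
  finally show ?thesis by (simp add: presented_group_def)
qed

lemma pres_one: "\<one>\<^bsub>presented_group X R\<^esub> = pres_rel X R `` {[]}"
  by (simp add: presented_group_def)

lemma winv_words [simp]: "w \<in> words X \<Longrightarrow> winv w \<in> words X"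
  by (auto simp: words_def winv_def)

lemma pres_eq_winv: "w \<in> words X \<Longrightarrow> pres_eq X R (winv w @ w) []"
proof (induction w)
  case Nil
  then show ?case by (simp add: winv_def pres_eq.refl)
next
  case (Cons a w)
  obtain x b where a: "a = (x, b)" by (cases a)
  have x: "x \<in> X" and w: "w \<in> words X" using Cons.prems a by auto
  have "pres_eq X R ((winv w @ [(x, \<not> b), (x, \<not> \<not> b)]) @ w) ((winv w @ []) @ w)"
    by (intro pres_eq.append pres_eq.refl pres_eq.cancel winv_words w x)
  then have "pres_eq X R (winv (a # w) @ a # w) (winv w @ w)"
    by (simp add: winv_def a)
  then show ?case using Cons.IH[OF w] by (rule pres_eq.trans)
qed

theorem presented_group_is_group: "group (presented_group X R)"
proof (rule groupI)
  fix A assume "A \<in> carrier (presented_group X R)"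
  then obtain u where u: "u \<in> words X" "A = pres_rel X R `` {u}" by (rule pres_carrierE)
  have "pres_rel X R `` {winv u} \<otimes>\<^bsub>presented_group X R\<^esub> A = \<one>\<^bsub>presented_group X R\<^esub>"
    using u pres_class_eq_iff[of "winv u @ u" X "[]" R] pres_eq_winv[of u X R]
    by (simp add: pres_one)
  then show "\<exists>B\<in>carrier (presented_group X R).
      B \<otimes>\<^bsub>presented_group X R\<^esub> A = \<one>\<^bsub>presented_group X R\<^esub>"
    using u by (meson pres_class_carrier winv_words)
qed (auto simp: pres_one elim!: pres_carrierE)

text \<open>The universal property of the presentation (von Dyck).\<close>

definition weval :: "('b, 'c) monoid_scheme \<Rightarrow> ('a \<Rightarrow> 'b) \<Rightarrow> 'a word \<Rightarrow> 'b" where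
  "weval G f w = foldr (\<lambda>(x, b) g. (if b then f x else inv\<^bsub>G\<^esub> (f x)) \<otimes>\<^bsub>G\<^esub> g) w \<one>\<^bsub>G\<^esub>"

theorem presented_group_universal:
  assumes "group G" and f: "f \<in> X \<rightarrow> carrier G"
    and rel: "\<And>r. r \<in> R \<Longrightarrow> weval G f r = \<one>\<^bsub>G\<^esub>"
  shows "\<exists>h \<in> hom (presented_group X R) G. \<forall>x\<in>X. h (pres_gen X R x) = f x"
proof -
  interpret group G by fact
  have fc: "f x \<in> carrier G" if "x \<in> X" for x
    using f that by auto
  have closed: "weval G f w \<in> carrier G" if "w \<in> words X" for w
    using that by (induction w) (auto simp: weval_def fc)
  have app: "weval G f (u @ v) = weval G f u \<otimes>\<^bsub>G\<^esub> weval G f v"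
    if "u \<in> words X" "v \<in> words X" for u v
    using that
  proof (induction u)
    case Nil
    then show ?case using closed[of v] by (simp add: weval_def)
  next
    case (Cons a u)
    obtain x b where a: "a = (x, b)" by (cases a)
    have "f x \<in> carrier G" "u \<in> words X" using Cons.prems fc a by auto
    moreover from this have "weval G f (u @ v) = weval G f u \<otimes>\<^bsub>G\<^esub> weval G f v"
      using Cons by simp
    moreover have "weval G f ((x, b) # w) = (if b then f x else inv\<^bsub>G\<^esub> (f x)) \<otimes>\<^bsub>G\<^esub> weval G f w" for w
      by (simp add: weval_def)
    ultimately show ?case using closed[of u] closed[of v] Cons.prems
      by (auto simp: a m_assoc)
  qed
  have resp: "weval G f u = weval G f v" if "pres_eq X R u v" for u v
    using that
  proof (induction rule: pres_eq.induct)
    case (append u u' v v')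
    then show ?case using app pres_eq_words by metis
  next
    case (cancel x b)
    then have "f x \<in> carrier G" using f by auto
    then show ?case by (simp add: weval_def)
  next
    case (relator r)
    then show ?case using rel by (simp add: weval_def)
  qed auto
  define h where "h A = weval G f (SOME u. u \<in> A)" for A
  have h: "h (pres_rel X R `` {u}) = weval G f u" if "u \<in> words X" for u
  proof -
    have "u \<in> pres_rel X R `` {u}"
      using that by (auto simp: pres_rel_def intro: pres_eq.refl)
    then have "(SOME w. w \<in> pres_rel X R `` {u}) \<in> pres_rel X R `` {u}"
      by (rule someI)
    then have "pres_eq X R u (SOME w. w \<in> pres_rel X R `` {u})"
      by (simp add: pres_rel_def)
    then show ?thesis using resp by (simp add: h_def)
  qed
  have "h \<in> hom (presented_group X R) G"
    by (rule homI) (auto simp: h closed app elim!: pres_carrierE)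
  moreover have "h (pres_gen X R x) = f x" if "x \<in> X" for x
    using that fc[OF that] h[of "[(x, True)]"] by (auto simp: pres_gen_def weval_def)
  ultimately show ?thesis by blast
qed


section \<open>String C-groups of rank 3\<close>

text \<open>The ordered generators are \<open>\<rho> 0, \<rho> 1, \<rho> 2\<close>; other values of \<open>\<rho>\<close> are irrelevant.\<close>

definition string_C_group3 :: "('a, 'b) monoid_scheme \<Rightarrow> (nat \<Rightarrow> 'a) \<Rightarrow> bool" where
  "string_C_group3 G \<rho> \<longleftrightarrow>
     group G \<and>
     (\<forall>i\<in>{0,1,2}. \<rho> i \<in> carrier G \<and> group.ord G (\<rho> i) = 2) \<and>
     generate G (\<rho> ` {0,1,2}) = carrier G \<and>
     \<rho> 0 \<otimes>\<^bsub>G\<^esub> \<rho> 2 = \<rho> 2 \<otimes>\<^bsub>G\<^esub> \<rho> 0 \<and>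
     (\<forall>I J. I \<subseteq> {0,1,2} \<longrightarrow> J \<subseteq> {0,1,2} \<longrightarrow>
        generate G (\<rho> ` I) \<inter> generate G (\<rho> ` J) = generate G (\<rho> ` (I \<inter> J)))"

definition schlafli_type :: "('a, 'b) monoid_scheme \<Rightarrow> (nat \<Rightarrow> 'a) \<Rightarrow> nat \<times> nat" where
  "schlafli_type G \<rho> =
     (group.ord G (\<rho> 0 \<otimes>\<^bsub>G\<^esub> \<rho> 1), group.ord G (\<rho> 1 \<otimes>\<^bsub>G\<^esub> \<rho> 2))"


section \<open>The three families of presentations\<close>

abbreviation r0 :: "nat word" where "r0 \<equiv> [(0, True)]"
abbreviation r1 :: "nat word" where "r1 \<equiv> [(1, True)]"
abbreviation r2 :: "nat word" where "r2 \<equiv> [(2, True)]"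

definition rels :: "nat word set" where
  "rels = {r0 \<up> 2, r1 \<up> 2, r2 \<up> 2, (r0 @ r1) \<up> 6, (r1 @ r2) \<up> 6, (r0 @ r2) \<up> 2,
           (r2 @ r1 @ r0 @ r1) \<up> 3}"

definition rels1 :: "nat \<Rightarrow> nat word set" where
  "rels1 m =
     {wconj ((r0 @ r2 @ r1) \<up> (4 * m)) r1,
      (r2 @ r1 @ r0) \<up> (4 * m),
      wconj ((r2 @ r1 @ r0) \<up> (4 * m)) r1}"

definition rels2 :: "nat \<Rightarrow> nat word set" where
  "rels2 m =
     {wconj (((r1 @ r2) \<up> 3 @ (r0 @ r1) \<up> 3) \<up> (2 * m)) (r0 @ r1),
      wconj (((r1 @ r2) \<up> 3 @ (r0 @ r1) \<up> 3) \<up> (2 * m)) r2,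
      wconj (((r1 @ r2) \<up> 3 @ (r0 @ r1) \<up> 3) \<up> (2 * m)) (r2 @ r1)}"

definition rels3 :: "nat \<Rightarrow> nat word set" where
  "rels3 m =
     {wconj (((r0 @ r1) \<up> 2 @ (r2 @ r1) \<up> 2) \<up> (3 * m)) r0,
      ((r1 @ r2) \<up> 2 @ (r1 @ r0) \<up> 2) \<up> (3 * m),
      wconj (((r1 @ r0) \<up> 2 @ (r1 @ r2) \<up> 2) \<up> (3 * m)) r2}"

definition grpG :: "nat \<Rightarrow> nat word set monoid" where
  "grpG m = presented_group {0,1,2} (rels \<union> rels1 m)"

definition genG :: "nat \<Rightarrow> nat \<Rightarrow> nat word set" where
  "genG m = pres_gen {0,1,2} (rels \<union> rels1 m)"

definition grpH :: "nat \<Rightarrow> nat word set monoid" where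
  "grpH m = presented_group {0,1,2} (rels \<union> rels2 m)"

definition genH :: "nat \<Rightarrow> nat \<Rightarrow> nat word set" where
  "genH m = pres_gen {0,1,2} (rels \<union> rels2 m)"

definition grpI :: "nat \<Rightarrow> nat word set monoid" where
  "grpI m = presented_group {0,1,2} (rels \<union> rels3 m)"

definition genI :: "nat \<Rightarrow> nat \<Rightarrow> nat word set" where
  "genI m = pres_gen {0,1,2} (rels \<union> rels3 m)"

end

theory Submission
  imports Defs
begin

text \<open>
  Write \<open>a, b, c\<close> for \<open>\<rho>\<^sub>0, \<rho>\<^sub>1, \<rho>\<^sub>2\<close>. Under the relators \<open>R\<close> alone, the involutions
  \<open>a, bcb, c, bab\<close> satisfy the relations of the affine Coxeter group of type \<open>A\<^sub>3\<close> (a 4-cycle), and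
  \<open>b\<close> acts as a reflection of the diagram. Hence every element is \<open>t w b\<^sup>e\<close> with \<open>t\<close> a translation in
  a lattice of rank 3, \<open>w\<close> one of 24 words and \<open>e < 2\<close>. The generators act on the integers by
  affine permutations: \<open>a\<close> exchanges 1, 2 and \<open>c\<close> exchanges 3, 4 modulo 4, and \<open>b\<close> is \<open>x \<mapsto> 6 - x\<close>;
  the action shows that the normal form is unique. The additional relators are translations that span an
  invariant lattice \<open>L\<close>. Two words are equal in the quotient iff their actions agree modulo \<open>4k\<close> up to
  a constant multiple of \<open>4h\<close>, where \<open>(k, h)\<close> is \<open>(2m, m)\<close>, \<open>(2m, 2m)\<close>, \<open>(4m, m)\<close> for the three families,
  and the order is \<open>48 h k\<^sup>2\<close>. Orders of products and the intersection property are detected by the action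
  modulo 8, and solvability by the chain of words that are even, act on residues modulo 4 by the Klein
  four-group, act trivially on residues modulo 4.
\<close>

section \<open>Involutions generating an affine group of type \<open>A\<^sub>3\<close>\<close>

context group
begin

lemma intertwine_inv:
  assumes "g \<in> carrier G" "x \<in> carrier G" "y \<in> carrier G" "g \<otimes> x = y \<otimes> g"
  shows "g \<otimes> inv x = inv y \<otimes> g"
proof -
  have "y \<otimes> (g \<otimes> inv x) = g"
    using assms(1-3) by (simp add: m_assoc[symmetric] assms(4)[symmetric]) (simp add: m_assoc)
  then show ?thesis
    using assms(1-3) inv_solve_left[of "g \<otimes> inv x" y g] by simp
qed

lemma int_pow_intertwine:
  assumes "g \<in> carrier G" "x \<in> carrier G" "y \<in> carrier G" "g \<otimes> x = y \<otimes> g"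
  shows "g \<otimes> x [^] (n::int) = y [^] n \<otimes> g"
proof -
  have nat: "g \<otimes> u [^] (k::nat) = w [^] k \<otimes> g"
    if "u \<in> carrier G" "w \<in> carrier G" "g \<otimes> u = w \<otimes> g" for u w k
  proof (induction k)
    case (Suc k)
    have "g \<otimes> u [^] Suc k = (g \<otimes> u [^] k) \<otimes> u"
      using that(1) assms(1) by (simp add: m_assoc)
    also have "\<dots> = w [^] k \<otimes> (g \<otimes> u)"
      using that(1,2) assms(1) by (simp add: Suc m_assoc)
    also have "\<dots> = w [^] Suc k \<otimes> g"
      using that(1,2) assms(1) by (simp add: that(3) m_assoc)
    finally show ?case .
  qed (use assms in simp)
  show ?thesis
  proof (cases "n < 0")
    case True
    then have "z [^] n = inv z [^] nat (- n)" if "z \<in> carrier G" for z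
      using that by (simp only: int_pow_def2 nat_pow_inv if_True)
    then show ?thesis
      using assms(2,3) nat[OF _ _ intertwine_inv[OF assms]] by simp
  next
    case False
    then show ?thesis
      using nat[OF assms(2-4)] by (simp only: int_pow_def2 if_False)
  qed
qed

lemma int_pow_commute:
  assumes "x \<in> carrier G" "y \<in> carrier G" "x \<otimes> y = y \<otimes> x"
  shows "x [^] (i::int) \<otimes> y [^] (j::int) = y [^] j \<otimes> x [^] i"
  using int_pow_intertwine[OF assms(2,1,1) assms(3)[symmetric], of i]
    int_pow_intertwine[of "x [^] i" y y j] assms(1,2) by simp

text \<open>For involutions, (xyx)(yxy) = (xy)^3 = 1, while yxy is its own inverse; cancelling yxy
  leaves the braid relation.\<close>

lemma braid_of_order_3:
  assumes "x \<in> carrier G" "y \<in> carrier G" "x \<otimes> x = \<one>" "y \<otimes> y = \<one>" "(x \<otimes> y) [^] (3::nat) = \<one>"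
  shows "x \<otimes> (y \<otimes> x) = y \<otimes> (x \<otimes> y)"
proof -
  have "(x \<otimes> (y \<otimes> x)) \<otimes> (y \<otimes> (x \<otimes> y)) = \<one>"
    using assms by (simp add: numeral_3_eq_3 m_assoc)
  moreover have "(y \<otimes> (x \<otimes> y)) \<otimes> (y \<otimes> (x \<otimes> y)) = \<one>"
  proof -
    have "(y \<otimes> (x \<otimes> y)) \<otimes> (y \<otimes> (x \<otimes> y)) = y \<otimes> (x \<otimes> (y \<otimes> y) \<otimes> x) \<otimes> y"
      using assms(1,2) by (simp only: m_assoc m_closed)
    also have "\<dots> = \<one>"
      using assms(1-4) by simp
    finally show ?thesis .
  qed
  ultimately show ?thesis
    using assms(1,2) by (metis m_closed right_cancel)
qed

end

section \<open>The Coxeter relations of the 4-cycle and its translations\<close>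

locale group_66_3 = group G for G (structure) +
  fixes a b c
  assumes closed [simp, intro]: "a \<in> carrier G" "b \<in> carrier G" "c \<in> carrier G"
    and invol [simp]: "a \<otimes> a = \<one>" "b \<otimes> b = \<one>" "c \<otimes> c = \<one>"
    and ac: "a \<otimes> c = c \<otimes> a"
    and ab6: "(a \<otimes> b) [^] (6::nat) = \<one>" and bc6: "(b \<otimes> c) [^] (6::nat) = \<one>"
    and cbab3: "(c \<otimes> b \<otimes> a \<otimes> b) [^] (3::nat) = \<one>"
begin

lemma invol_tail [simp]:
  assumes "z \<in> carrier G"
  shows "a \<otimes> (a \<otimes> z) = z" "b \<otimes> (b \<otimes> z) = z" "c \<otimes> (c \<otimes> z) = z"
  using assms by (simp_all add: m_assoc[symmetric])

text \<open>\<open>a\<close>, \<open>p\<close>, \<open>c\<close>, \<open>d\<close> are the consecutive nodes of the 4-cycle.\<close>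

definition p where "p = b \<otimes> (c \<otimes> b)"
definition d where "d = b \<otimes> (a \<otimes> b)"

lemma p_closed [simp, intro]: "p \<in> carrier G" and d_closed [simp, intro]: "d \<in> carrier G"
  by (simp_all add: p_def d_def)

lemma b_shift:
  shows "b \<otimes> a = d \<otimes> b" "b \<otimes> d = a \<otimes> b" "b \<otimes> c = p \<otimes> b" "b \<otimes> p = c \<otimes> b"
  by (simp_all add: p_def d_def m_assoc)

lemma b_shift_tail:
  assumes "z \<in> carrier G"
  shows "b \<otimes> (a \<otimes> z) = d \<otimes> (b \<otimes> z)" "b \<otimes> (d \<otimes> z) = a \<otimes> (b \<otimes> z)"
    "b \<otimes> (c \<otimes> z) = p \<otimes> (b \<otimes> z)" "b \<otimes> (p \<otimes> z) = c \<otimes> (b \<otimes> z)"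
  using assms by (simp_all add: b_shift m_assoc[symmetric])

lemma pp [simp]: "p \<otimes> p = \<one>" and dd [simp]: "d \<otimes> d = \<one>"
  by (simp_all add: p_def d_def m_assoc)

lemma pp_tail [simp]: "z \<in> carrier G \<Longrightarrow> p \<otimes> (p \<otimes> z) = z"
  and dd_tail [simp]: "z \<in> carrier G \<Longrightarrow> d \<otimes> (d \<otimes> z) = z"
  by (simp_all add: m_assoc[symmetric])

lemma pd: "p \<otimes> d = d \<otimes> p"
proof -
  have "p \<otimes> d = b \<otimes> (c \<otimes> a) \<otimes> b" by (simp add: p_def d_def m_assoc)
  also have "\<dots> = b \<otimes> (a \<otimes> c) \<otimes> b" by (simp add: ac)
  also have "\<dots> = d \<otimes> p" by (simp add: p_def d_def m_assoc)
  finally show ?thesis .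
qed

text \<open>Since ad = (ab)^2 and pc = (bc)^2, the relators with exponent 6 become cubes; the
  remaining cubic relator is (cd)^3 itself.\<close>

lemma braid_ad: "a \<otimes> (d \<otimes> a) = d \<otimes> (a \<otimes> d)"
  using ab6 by (intro braid_of_order_3) (simp_all add: d_def eval_nat_numeral m_assoc)

lemma braid_pc: "p \<otimes> (c \<otimes> p) = c \<otimes> (p \<otimes> c)"
  using bc6 by (intro braid_of_order_3) (simp_all add: p_def eval_nat_numeral m_assoc)

lemma braid_cd: "c \<otimes> (d \<otimes> c) = d \<otimes> (c \<otimes> d)"
  using cbab3 by (intro braid_of_order_3) (simp_all add: d_def m_assoc)

text \<open>Conjugating the relation \<open>braid_cd\<close> by b sends c to p and d to a.\<close>

lemma braid_ap: "a \<otimes> (p \<otimes> a) = p \<otimes> (a \<otimes> p)"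
proof -
  have "b \<otimes> (c \<otimes> (d \<otimes> c)) \<otimes> b = b \<otimes> (d \<otimes> (c \<otimes> d)) \<otimes> b"
    by (simp add: braid_cd)
  then show ?thesis by (simp add: b_shift b_shift_tail m_assoc)
qed


text \<open>Each equation is oriented towards the side that comes first lexicographically for a < p
  < c < d; both sides have the same length, so rewriting terminates.\<close>

lemma cox_base:
  shows "c \<otimes> a = a \<otimes> c" "d \<otimes> p = p \<otimes> d"
    "p \<otimes> (a \<otimes> p) = a \<otimes> (p \<otimes> a)" "c \<otimes> (p \<otimes> c) = p \<otimes> (c \<otimes> p)"
    "d \<otimes> (c \<otimes> d) = c \<otimes> (d \<otimes> c)" "d \<otimes> (a \<otimes> d) = a \<otimes> (d \<otimes> a)"
  by (simp_all add: ac pd braid_ap braid_pc braid_cd braid_ad)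

lemma left_mult_tail:
  assumes "x \<otimes> y = u" "x \<in> carrier G" "y \<in> carrier G" "z \<in> carrier G"
  shows "x \<otimes> (y \<otimes> z) = u \<otimes> z"
  using assms by (simp add: m_assoc[symmetric])

lemma cox_base_tail:
  assumes "z \<in> carrier G"
  shows "c \<otimes> (a \<otimes> z) = a \<otimes> (c \<otimes> z)" "d \<otimes> (p \<otimes> z) = p \<otimes> (d \<otimes> z)"
    "p \<otimes> (a \<otimes> (p \<otimes> z)) = a \<otimes> (p \<otimes> (a \<otimes> z))" "c \<otimes> (p \<otimes> (c \<otimes> z)) = p \<otimes> (c \<otimes> (p \<otimes> z))"
    "d \<otimes> (c \<otimes> (d \<otimes> z)) = c \<otimes> (d \<otimes> (c \<otimes> z))" "d \<otimes> (a \<otimes> (d \<otimes> z)) = a \<otimes> (d \<otimes> (a \<otimes> z))"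
  using assms cox_base[THEN left_mult_tail] by (simp_all add: m_assoc)

text \<open>The consequences of the Coxeter relations that make rewriting decide the word identities below;
  \<open>tail\<close> versions are needed because the products are nested to the right.\<close>

lemma cox_long:
  shows "d \<otimes> (a \<otimes> (p \<otimes> a)) = p \<otimes> (d \<otimes> (a \<otimes> p))" "d \<otimes> (a \<otimes> (p \<otimes> d)) = a \<otimes> (d \<otimes> (a \<otimes> p))"
    "c \<otimes> (p \<otimes> (a \<otimes> c)) = p \<otimes> (c \<otimes> (p \<otimes> a))" "d \<otimes> (c \<otimes> (p \<otimes> d)) = c \<otimes> (d \<otimes> (c \<otimes> p))"
proof -
  have "d \<otimes> (p \<otimes> (a \<otimes> p)) = p \<otimes> (d \<otimes> (a \<otimes> p))" by (simp add: cox_base_tail)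
  then show "d \<otimes> (a \<otimes> (p \<otimes> a)) = p \<otimes> (d \<otimes> (a \<otimes> p))" by (simp add: cox_base)
  have "d \<otimes> (a \<otimes> (d \<otimes> p)) = a \<otimes> (d \<otimes> (a \<otimes> p))" by (simp add: cox_base_tail)
  then show "d \<otimes> (a \<otimes> (p \<otimes> d)) = a \<otimes> (d \<otimes> (a \<otimes> p))" by (simp add: pd)
  have "c \<otimes> (p \<otimes> (c \<otimes> a)) = p \<otimes> (c \<otimes> (p \<otimes> a))" by (simp add: cox_base_tail)
  then show "c \<otimes> (p \<otimes> (a \<otimes> c)) = p \<otimes> (c \<otimes> (p \<otimes> a))" by (simp add: ac)
  have "d \<otimes> (c \<otimes> (d \<otimes> p)) = c \<otimes> (d \<otimes> (c \<otimes> p))" by (simp add: cox_base_tail)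
  then show "d \<otimes> (c \<otimes> (p \<otimes> d)) = c \<otimes> (d \<otimes> (c \<otimes> p))" by (simp add: pd)
qed

lemma cox_long_tail:
  assumes "z \<in> carrier G"
  shows "d \<otimes> (a \<otimes> (p \<otimes> (a \<otimes> z))) = p \<otimes> (d \<otimes> (a \<otimes> (p \<otimes> z)))"
    "d \<otimes> (a \<otimes> (p \<otimes> (d \<otimes> z))) = a \<otimes> (d \<otimes> (a \<otimes> (p \<otimes> z)))"
    "c \<otimes> (p \<otimes> (a \<otimes> (c \<otimes> z))) = p \<otimes> (c \<otimes> (p \<otimes> (a \<otimes> z)))"
    "d \<otimes> (c \<otimes> (p \<otimes> (d \<otimes> z))) = c \<otimes> (d \<otimes> (c \<otimes> (p \<otimes> z)))"
  using assms cox_long[THEN left_mult_tail] by (simp_all add: m_assoc)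

lemmas cox = cox_base cox_base_tail cox_long cox_long_tail

text \<open>For the standard basis \<open>e\<^sub>i\<close> of \<open>\<int>\<^sup>4\<close>, \<open>x1\<close>, \<open>x2\<close>, \<open>x3\<close> are the translations by
  \<open>e\<^sub>i - e\<^sub>4\<close>: \<open>apcpa\<close> is the reflection in the highest root, and \<open>d\<close> the affine reflection parallel to it.\<close>

definition x1 where "x1 = d \<otimes> (a \<otimes> (p \<otimes> (c \<otimes> (p \<otimes> a))))"
definition x2 where "x2 = a \<otimes> (x1 \<otimes> a)"
definition x3 where "x3 = p \<otimes> (x2 \<otimes> p)"

lemma x_closed [simp, intro]: "x1 \<in> carrier G" "x2 \<in> carrier G" "x3 \<in> carrier G"
  by (simp_all add: x1_def x2_def x3_def)

lemma a_x: "a \<otimes> x1 = x2 \<otimes> a" "a \<otimes> x2 = x1 \<otimes> a" "a \<otimes> x3 = x3 \<otimes> a"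
  by (simp_all add: x1_def x2_def x3_def m_assoc cox)

lemma p_x: "p \<otimes> x1 = x1 \<otimes> p" "p \<otimes> x2 = x3 \<otimes> p" "p \<otimes> x3 = x2 \<otimes> p"
  by (simp_all add: x1_def x2_def x3_def m_assoc cox)

text \<open>With q = pcp, the elements a, q, d satisfy pairwise braid relations, which is affine
  type \<open>A\<^sub>2\<close>. There x1 = d(aqa) and x2 = (ada)q, and both products x1 x2 and x2
  x1 reduce to daqdaq.\<close>

lemma x1_x2: "x1 \<otimes> x2 = x2 \<otimes> x1"
proof -
  define q where "q = p \<otimes> (c \<otimes> p)"
  have q: "q \<in> carrier G" by (simp add: q_def)
  have x1: "x1 = d \<otimes> (a \<otimes> (q \<otimes> a))" and x2: "x2 = a \<otimes> (d \<otimes> (a \<otimes> q))"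
    by (simp_all add: x1_def x2_def q_def m_assoc)
  have x2': "x2 = d \<otimes> (a \<otimes> (d \<otimes> q))"
    by (simp add: x2 q cox)
  have qq: "q \<otimes> q = \<one>" by (simp add: q_def m_assoc)
  have qdq: "q \<otimes> (d \<otimes> q) = d \<otimes> (q \<otimes> d)"
    by (simp add: q_def m_assoc cox)
  have qaq: "a \<otimes> (q \<otimes> a) = q \<otimes> (a \<otimes> q)"
    by (simp add: q_def m_assoc cox)
  have "x2 \<otimes> x1 = d \<otimes> (a \<otimes> ((d \<otimes> (q \<otimes> d)) \<otimes> (a \<otimes> (q \<otimes> a))))"
    by (simp add: x2' x1 q m_assoc)
  also have "\<dots> = d \<otimes> (a \<otimes> (q \<otimes> (d \<otimes> (q \<otimes> (q \<otimes> (a \<otimes> q))))))"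
    by (simp add: qdq[symmetric] qaq q m_assoc)
  also have "\<dots> = d \<otimes> (a \<otimes> (q \<otimes> (d \<otimes> (a \<otimes> q))))"
    using left_mult_tail[OF qq q q] q by simp
  also have "\<dots> = x1 \<otimes> x2"
    by (simp add: x1 x2 q m_assoc)
  finally show ?thesis by simp
qed

text \<open>One computed commutation is enough: p carries the pair x1, x2 to x1, x3, and a carries
  that pair to x2, x3.\<close>

lemma conj_commute:
  assumes "g \<otimes> u = u' \<otimes> g" "g \<otimes> v = v' \<otimes> g" "u \<otimes> v = v \<otimes> u"
    "g \<in> carrier G" "u \<in> carrier G" "v \<in> carrier G" "u' \<in> carrier G" "v' \<in> carrier G"
  shows "u' \<otimes> v' = v' \<otimes> u'"
proof -
  have 1: "g \<otimes> (u \<otimes> v) = u' \<otimes> v' \<otimes> g" if "g \<otimes> u = u' \<otimes> g" "g \<otimes> v = v' \<otimes> g"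
    "u \<in> carrier G" "v \<in> carrier G" "u' \<in> carrier G" "v' \<in> carrier G" for u v u' v'
  proof -
    have "g \<otimes> (u \<otimes> v) = u' \<otimes> (g \<otimes> v)"
      using that assms(4) by (metis m_assoc)
    also have "\<dots> = u' \<otimes> v' \<otimes> g" using that assms(4) by (simp add: m_assoc)
    finally show ?thesis .
  qed
  have "u' \<otimes> v' \<otimes> g = v' \<otimes> u' \<otimes> g"
    using 1[of u u' v v'] 1[of v v' u u'] assms by simp
  then show ?thesis using assms by simp
qed

lemma x1_x3: "x1 \<otimes> x3 = x3 \<otimes> x1"
  by (rule conj_commute[OF p_x(1,2) x1_x2]) auto

lemma x2_x3: "x2 \<otimes> x3 = x3 \<otimes> x2"
  by (rule conj_commute[OF a_x(1,3) x1_x3]) auto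

lemma x_inv_commute:
  "x1 \<otimes> inv x3 = inv x3 \<otimes> x1" "x2 \<otimes> inv x3 = inv x3 \<otimes> x2" "x2 \<otimes> inv x1 = inv x1 \<otimes> x2"
  using intertwine_inv[OF _ _ _ x1_x3] intertwine_inv[OF _ _ _ x2_x3]
    intertwine_inv[OF _ _ _ x1_x2[symmetric]] by simp_all

text \<open>The rules \<open>cox\<close> contain no inverses. Multiplying by x turns a conjugation
  formula with \<open>inv x\<close> into an inverse-free identity that they can decide.\<close>

lemma solve_x:
  assumes "x \<otimes> (g \<otimes> u) = w \<otimes> g" "w \<otimes> inv x = inv x \<otimes> w"
    "x \<in> carrier G" "g \<in> carrier G" "u \<in> carrier G" "w \<in> carrier G"
  shows "g \<otimes> u = (w \<otimes> inv x) \<otimes> g"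
proof -
  have "g \<otimes> u = inv x \<otimes> (w \<otimes> g)"
    using assms inv_solve_left[of "g \<otimes> u" x "w \<otimes> g"] by simp
  then show ?thesis using assms(2-) by (simp add: m_assoc[symmetric])
qed

text \<open>c acts on the lattice as the transposition (3 4): e_3 - e_4 changes sign, and e_i - e_4
  becomes e_i - e_3 for i = 1, 2.\<close>

lemma c_x: "c \<otimes> x3 = inv x3 \<otimes> c" "c \<otimes> x1 = (x1 \<otimes> inv x3) \<otimes> c" "c \<otimes> x2 = (x2 \<otimes> inv x3) \<otimes> c"
proof -
  have "x3 \<otimes> (c \<otimes> x3) = c"
    by (simp add: x1_def x2_def x3_def m_assoc cox)
  then show "c \<otimes> x3 = inv x3 \<otimes> c"
    using inv_solve_left[of "c \<otimes> x3" x3 c] by simp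
  show "c \<otimes> x1 = (x1 \<otimes> inv x3) \<otimes> c"
    by (rule solve_x) (simp_all add: x_inv_commute(1), simp add: x1_def x2_def x3_def m_assoc cox)
  show "c \<otimes> x2 = (x2 \<otimes> inv x3) \<otimes> c"
    by (rule solve_x) (simp_all add: x_inv_commute(2), simp add: x1_def x2_def x3_def m_assoc cox)
qed

text \<open>b acts on the lattice as the negative of the transposition (2 4): e_2 - e_4 is fixed,
  and e_i - e_4 becomes e_2 - e_i for i = 1, 3.\<close>

lemma b_x: "b \<otimes> x1 = (x2 \<otimes> inv x1) \<otimes> b" "b \<otimes> x2 = x2 \<otimes> b" "b \<otimes> x3 = (x2 \<otimes> inv x3) \<otimes> b"
proof -
  show "b \<otimes> x2 = x2 \<otimes> b"
    by (simp add: x1_def x2_def m_assoc b_shift b_shift_tail cox)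
  have "x1 \<otimes> (b \<otimes> x1) = x2 \<otimes> b" "x3 \<otimes> (b \<otimes> x3) = x2 \<otimes> b"
    by (simp_all add: x1_def x2_def x3_def m_assoc b_shift b_shift_tail cox)
  then show "b \<otimes> x1 = (x2 \<otimes> inv x1) \<otimes> b" "b \<otimes> x3 = (x2 \<otimes> inv x3) \<otimes> b"
    using solve_x[OF _ x_inv_commute(3)] solve_x[OF _ x_inv_commute(2)] by simp_all
qed

end

section \<open>Normal forms\<close>

context group_66_3
begin

definition tr :: "int \<Rightarrow> int \<Rightarrow> int \<Rightarrow> 'a" where
  "tr i j k = x1 [^] i \<otimes> x2 [^] j \<otimes> x3 [^] k"

lemma tr_closed [simp, intro]: "tr i j k \<in> carrier G"
  by (simp add: tr_def)

lemma tr_0 [simp]: "tr 0 0 0 = \<one>"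
  by (simp add: tr_def)

lemma tr_mult: "tr i j k \<otimes> tr i' j' k' = tr (i + i') (j + j') (k + k')"
proof -
  note comm = int_pow_commute[OF _ _ x1_x2] int_pow_commute[OF _ _ x1_x3] int_pow_commute[OF _ _ x2_x3]
  have "tr i j k \<otimes> tr i' j' k' = x1 [^] i \<otimes> (x2 [^] j \<otimes> (x3 [^] k \<otimes> (x1 [^] i' \<otimes> (x2 [^] j' \<otimes> x3 [^] k'))))"
    by (simp add: tr_def m_assoc)
  also have "x3 [^] k \<otimes> (x1 [^] i' \<otimes> (x2 [^] j' \<otimes> x3 [^] k')) = x1 [^] i' \<otimes> (x3 [^] k \<otimes> (x2 [^] j' \<otimes> x3 [^] k'))"
    using left_mult_tail[OF comm(2)[symmetric]] by (simp add: m_assoc)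
  also have "x3 [^] k \<otimes> (x2 [^] j' \<otimes> x3 [^] k') = x2 [^] j' \<otimes> x3 [^] (k + k')"
    using left_mult_tail[OF comm(3)[symmetric]] by (simp add: m_assoc int_pow_mult)
  also have "x2 [^] j \<otimes> (x1 [^] i' \<otimes> (x2 [^] j' \<otimes> x3 [^] (k + k'))) = x1 [^] i' \<otimes> (x2 [^] (j + j') \<otimes> x3 [^] (k + k'))"
    using left_mult_tail[OF comm(1)[symmetric]] by (simp add: m_assoc int_pow_mult)
  also have "x1 [^] i \<otimes> (x1 [^] i' \<otimes> (x2 [^] (j + j') \<otimes> x3 [^] (k + k'))) = tr (i + i') (j + j') (k + k')"
    by (simp add: tr_def m_assoc int_pow_mult)
  finally show ?thesis .
qed

lemma tr_inv: "inv (tr i j k) = tr (- i) (- j) (- k)"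
  by (rule inv_equality) (simp_all add: tr_mult)

lemma tr_nat_pow: "tr i j k [^] (n::nat) = tr (int n * i) (int n * j) (int n * k)"
  by (induction n) (simp_all add: tr_mult algebra_simps)

lemma tr_int_pow: "tr i j k [^] (n::int) = tr (n * i) (n * j) (n * k)"
proof (cases "n < 0")
  case True
  then show ?thesis
    by (simp only: int_pow_def2 if_True tr_nat_pow tr_inv) simp
next
  case False
  then show ?thesis
    by (simp only: int_pow_def2 if_False tr_nat_pow) simp
qed

lemma x_tr: "x1 = tr 1 0 0" "x2 = tr 0 1 0" "x3 = tr 0 0 1"
  by (simp_all add: tr_def)

text \<open>The three triples are the rows of the matrix by which g acts on the lattice, so its
  action is known once it is known on the basis.\<close>

lemma intertwine_tr:
  assumes "g \<otimes> x1 = tr i1 j1 k1 \<otimes> g" "g \<otimes> x2 = tr i2 j2 k2 \<otimes> g" "g \<otimes> x3 = tr i3 j3 k3 \<otimes> g"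
    and g: "g \<in> carrier G"
  shows "g \<otimes> tr i j k = tr (i * i1 + j * i2 + k * i3) (i * j1 + j * j2 + k * j3) (i * k1 + j * k2 + k * k3) \<otimes> g"
proof -
  note p = assms(1-3)[THEN int_pow_intertwine[rotated 3]]
  have "g \<otimes> tr i j k = g \<otimes> x1 [^] i \<otimes> x2 [^] j \<otimes> x3 [^] k"
    using g by (simp add: tr_def m_assoc)
  also have "\<dots> = tr i1 j1 k1 [^] i \<otimes> (g \<otimes> x2 [^] j) \<otimes> x3 [^] k"
    using g by (simp add: p(1) m_assoc)
  also have "\<dots> = tr i1 j1 k1 [^] i \<otimes> tr i2 j2 k2 [^] j \<otimes> (g \<otimes> x3 [^] k)"
    using g by (simp add: p(2) m_assoc)
  also have "\<dots> = tr i1 j1 k1 [^] i \<otimes> tr i2 j2 k2 [^] j \<otimes> tr i3 j3 k3 [^] k \<otimes> g"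
    using g by (simp add: p(3) m_assoc)
  finally show ?thesis
    by (simp add: tr_int_pow tr_mult)
qed

lemma gen_tr:
  shows "a \<otimes> tr i j k = tr j i k \<otimes> a" "p \<otimes> tr i j k = tr i k j \<otimes> p"
    "c \<otimes> tr i j k = tr i j (- i - j - k) \<otimes> c" "b \<otimes> tr i j k = tr (- i) (i + j + k) (- k) \<otimes> b"
proof -
  show "a \<otimes> tr i j k = tr j i k \<otimes> a"
    using intertwine_tr[of a 0 1 0 1 0 0 0 0 1] a_x by (simp add: x_tr)
  show "p \<otimes> tr i j k = tr i k j \<otimes> p"
    using intertwine_tr[of p 1 0 0 0 0 1 0 1 0] p_x by (simp add: x_tr)
  show "c \<otimes> tr i j k = tr i j (- i - j - k) \<otimes> c"
    using intertwine_tr[of c 1 0 "-1" 0 1 "-1" 0 0 "-1"] c_x by (simp add: x_tr tr_inv tr_mult)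
  show "b \<otimes> tr i j k = tr (- i) (i + j + k) (- k) \<otimes> b"
    using intertwine_tr[of b "-1" 1 0 0 1 0 0 1 "-1"] b_x by (simp add: x_tr tr_inv tr_mult)
qed

section \<open>The symmetric group of degree 4 and the affine group\<close>

definition cgen :: "nat \<Rightarrow> 'a" where
  "cgen i = (if i = 0 then a else if i = 1 then p else c)"

definition cval :: "nat list \<Rightarrow> 'a" where
  "cval u = foldr (\<lambda>i z. cgen i \<otimes> z) u \<one>"

lemma cgen_closed [simp, intro]: "cgen i \<in> carrier G"
  by (simp add: cgen_def)

lemma cval_closed [simp, intro]: "cval u \<in> carrier G"
  by (induction u) (simp_all add: cval_def)

lemma cval_Cons: "cval (i # u) = cgen i \<otimes> cval u"
  by (simp add: cval_def)

end

text \<open>Here the letters 0, 1, 2 stand for \<open>a, p, c\<close>, not for \<open>a, b, c\<close>.\<close>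

definition perms :: "nat list list" where
  "perms = [u @ v @ w. u \<leftarrow> [[], [0]], v \<leftarrow> [[], [1], [1, 0]], w \<leftarrow> [[], [2], [2, 1], [2, 1, 0]]]"

context group_66_3
begin

text \<open>The three factors of a word in \<open>perms\<close> are coset representatives along the
  chain of symmetric groups generated by a, by a, p and by a, p, c. The 24 words are irreducible for
  \<open>cox\<close>, so a left multiple simplifies to one of them.\<close>

lemma perms_closed:
  assumes "u \<in> set perms"
  shows "\<exists>u'\<in>set perms. cgen i \<otimes> cval u = cval u'"
proof -
  have "a \<otimes> cval u \<in> cval ` set perms \<and> p \<otimes> cval u \<in> cval ` set perms \<and> c \<otimes> cval u \<in> cval ` set perms"
    using assms unfolding perms_def
    by (simp, elim disjE; simp add: cval_def cgen_def cox)
  then show ?thesis by (auto simp: cgen_def)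
qed

definition aff :: "'a set" where
  "aff = {tr i j k \<otimes> cval u |i j k u. u \<in> set perms}"

lemma affI: "u \<in> set perms \<Longrightarrow> tr i j k \<otimes> cval u \<in> aff"
  by (auto simp: aff_def)

lemma affE:
  assumes "z \<in> aff"
  obtains i j k u where "u \<in> set perms" "z = tr i j k \<otimes> cval u"
  using assms by (auto simp: aff_def)

lemma aff_closed: "z \<in> aff \<Longrightarrow> z \<in> carrier G"
  by (auto simp: aff_def)

lemma tr_aff: "z \<in> aff \<Longrightarrow> tr i j k \<otimes> z \<in> aff"
  by (auto elim!: affE intro!: affI simp: m_assoc[symmetric] tr_mult)

lemma one_aff: "\<one> \<in> aff"
  using affI[of "[]" 0 0 0] by (simp add: perms_def cval_def)

lemma cgen_aff:
  assumes "z \<in> aff"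
  shows "cgen n \<otimes> z \<in> aff"
  using assms
proof (rule affE)
  fix i j k u assume u: "u \<in> set perms" "z = tr i j k \<otimes> cval u"
  obtain i' j' k' where "cgen n \<otimes> tr i j k = tr i' j' k' \<otimes> cgen n"
    using gen_tr by (metis cgen_def)
  then have "cgen n \<otimes> z = tr i' j' k' \<otimes> (cgen n \<otimes> cval u)"
    using left_mult_tail[of "cgen n" "tr i j k"] by (simp add: u m_assoc)
  then show ?thesis
    using perms_closed[OF u(1), of n] by (auto intro: affI)
qed

lemma gen_aff:
  assumes "z \<in> aff"
  shows "a \<otimes> z \<in> aff" "p \<otimes> z \<in> aff" "c \<otimes> z \<in> aff" "d \<otimes> z \<in> aff"
proof -
  have *: "a \<otimes> z \<in> aff" "p \<otimes> z \<in> aff" "c \<otimes> z \<in> aff" if "z \<in> aff" for z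
    using cgen_aff[OF that, of 0] cgen_aff[OF that, of 1] cgen_aff[OF that, of 2]
    by (simp_all add: cgen_def)
  show "a \<otimes> z \<in> aff" "p \<otimes> z \<in> aff" "c \<otimes> z \<in> aff"
    using assms by (simp_all add: *)
  \<comment> \<open>The word apcpa is an involution, so x1 = d(apcpa) yields d = x1(apcpa).\<close>
  have "d \<otimes> z = x1 \<otimes> (a \<otimes> (p \<otimes> (c \<otimes> (p \<otimes> (a \<otimes> z)))))"
    using aff_closed[OF assms] by (simp add: x1_def m_assoc)
  then show "d \<otimes> z \<in> aff"
    using assms by (simp add: * tr_aff x_tr(1))
qed

text \<open>Moving b to the right turns a into d, which is not a letter of \<open>perms\<close>;
  this is why the result is placed in \<open>aff\<close>, where d contributes a translation.\<close>

lemma b_cval: "\<exists>z\<in>aff. b \<otimes> cval u = z \<otimes> b"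
proof (induction u)
  case Nil
  then show ?case using one_aff by (force simp: cval_def)
next
  case (Cons i u)
  then obtain z where z: "z \<in> aff" "b \<otimes> cval u = z \<otimes> b" by blast
  have "\<exists>g\<in>{d, p, c}. b \<otimes> cgen i = g \<otimes> b"
    by (auto simp: cgen_def b_shift)
  then obtain g where g: "g \<in> {d, p, c}" "b \<otimes> cgen i = g \<otimes> b" by blast
  then have gc: "g \<in> carrier G" by auto
  have "b \<otimes> cval (i # u) = g \<otimes> (b \<otimes> cval u)"
    using left_mult_tail[OF g(2)] gc by (simp add: cval_Cons m_assoc)
  also have "\<dots> = (g \<otimes> z) \<otimes> b"
    using gc aff_closed[OF z(1)] by (simp add: z m_assoc)
  finally show ?case
    using g(1) gen_aff[OF z(1)] by auto
qed

lemma b_aff: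
  assumes "z \<in> aff"
  shows "\<exists>z'\<in>aff. b \<otimes> z = z' \<otimes> b"
  using assms
proof (rule affE)
  fix i j k u assume u: "u \<in> set perms" "z = tr i j k \<otimes> cval u"
  obtain y where y: "y \<in> aff" "b \<otimes> cval u = y \<otimes> b"
    using b_cval by blast
  obtain i' j' k' where t: "b \<otimes> tr i j k = tr i' j' k' \<otimes> b"
    using gen_tr by blast
  have "b \<otimes> z = tr i' j' k' \<otimes> (b \<otimes> cval u)"
    using left_mult_tail[OF t] by (simp add: u m_assoc)
  also have "\<dots> = (tr i' j' k' \<otimes> y) \<otimes> b"
    using aff_closed[OF y(1)] by (simp add: y m_assoc)
  finally show ?thesis
    using tr_aff[OF y(1)] by blast
qed

text \<open>One value serves both signs of a letter because the generators are involutions.\<close>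

definition val :: "nat word \<Rightarrow> 'a" where
  "val w = foldr (\<lambda>(i, _) z. (if i = 0 then a else if i = 1 then b else c) \<otimes> z) w \<one>"

lemma val_closed [simp, intro]: "val w \<in> carrier G"
  by (induction w) (auto simp: val_def)

text \<open>Induction on the word: a and c act on \<open>aff\<close> from the left, while b is
  carried across to the right end and toggles the exponent e there.\<close>

lemma val_normal_form:
  "\<exists>i j k u e. u \<in> set perms \<and> val w = tr i j k \<otimes> cval u \<otimes> b [^] (e::nat) \<and> e < 2"
proof -
  have "\<exists>z\<in>aff. \<exists>e<2. val w = z \<otimes> b [^] (e::nat)"
  proof (induction w)
    case Nil
    then show ?case
      using one_aff by (intro bexI[of _ "\<one>"] exI[of _ 0]) (auto simp: val_def)
  next
    case (Cons x w)
    then obtain z e where z: "z \<in> aff" "e < 2" "val w = z \<otimes> b [^] (e::nat)" by blast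
    obtain i s where x: "x = (i, s)" by (cases x)
    show ?case
    proof (cases "i = 1")
      case True
      obtain z' where z': "z' \<in> aff" "b \<otimes> z = z' \<otimes> b"
        using b_aff[OF z(1)] by blast
      have "val (x # w) = b \<otimes> (z \<otimes> b [^] e)"
        using True by (simp add: x val_def flip: z(3))
      also have "\<dots> = z' \<otimes> (b \<otimes> b [^] e)"
        using left_mult_tail[OF z'(2)] aff_closed[OF z(1)] aff_closed[OF z'(1)] by (simp add: m_assoc)
      also have "b \<otimes> b [^] e = b [^] (1 - e)"
        using z(2) by (cases "e = 0") (auto simp: less_2_cases_iff)
      finally show ?thesis
        using z'(1) by (intro bexI[of _ z'] exI[of _ "1 - e"]) auto
    next
      case False
      define g where "g = (if i = 0 then a else c)"
      have "val (x # w) = g \<otimes> (z \<otimes> b [^] e)"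
        using False by (simp add: x val_def g_def flip: z(3))
      then have "val (x # w) = (g \<otimes> z) \<otimes> b [^] e"
        using aff_closed[OF z(1)] by (simp add: m_assoc g_def)
      moreover have "g \<otimes> z \<in> aff"
        using gen_aff[OF z(1)] by (simp add: g_def)
      ultimately show ?thesis using z(2) by blast
    qed
  qed
  then obtain z e where z: "z \<in> aff" "e < 2" "val w = z \<otimes> b [^] (e::nat)" by blast
  from z(1) show ?thesis
    by (rule affE) (use z(2,3) in blast)
qed

end

section \<open>Action on the integers\<close>

lemma residues_4: "(x::int) mod 4 = 0 \<or> x mod 4 = 1 \<or> x mod 4 = 2 \<or> x mod 4 = 3"
  by presburger

text \<open>The reflection has centre 3, so that bcb exchanges 2, 3 and bab exchanges 4, 5 modulo 4.
  Thus a, bcb, c, bab become the standard generators of the affine symmetric group of degree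
  4.\<close>

definition letter_act :: "nat \<Rightarrow> int \<Rightarrow> int" where
  "letter_act i x =
     (if i = 1 then 6 - x
      else if i = 0 then (if x mod 4 = 1 then x + 1 else if x mod 4 = 2 then x - 1 else x)
      else (if x mod 4 = 3 then x + 1 else if x mod 4 = 0 then x - 1 else x))"

definition act :: "nat word \<Rightarrow> int \<Rightarrow> int" where
  "act w = foldr (\<lambda>(i, _) f. letter_act i \<circ> f) w id"

lemma act_Nil [simp]: "act [] = id"
  and act_Cons [simp]: "act ((i, s) # w) = letter_act i \<circ> act w"
  by (simp_all add: act_def)

lemma act_append [simp]: "act (u @ v) = act u \<circ> act v"
  by (induction u) (auto simp: fun_eq_iff)

lemma letter_act_invol [simp]: "letter_act i (letter_act i x) = x"
proof -
  have m: "x mod 4 = 1 \<Longrightarrow> (x + 1) mod 4 = 2" "x mod 4 = 2 \<Longrightarrow> (x - 1) mod 4 = 1"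
    "x mod 4 = 3 \<Longrightarrow> (x + 1) mod 4 = 0" "x mod 4 = 0 \<Longrightarrow> (x - 1) mod 4 = 3"
    by presburger+
  show ?thesis
    using residues_4[of x] by (elim disjE) (simp_all add: letter_act_def m)
qed

lemma act_winv: "act (winv w) (act w x) = x" "act w (act (winv w) x) = x"
  by (induction w arbitrary: x) (auto simp: winv_def)

lemma letter_act_periodic: "letter_act i (x + 4 * n) = letter_act i x + 4 * (if i = 1 then - n else n)"
  using residues_4[of x] by (auto simp: letter_act_def)

text \<open>Only b reverses the line, so s is -1 exactly when b occurs an odd number of times;
  \<open>act_balanced\<close> makes this explicit.\<close>

lemma act_periodic: "\<exists>s. (s = 1 \<or> s = -1) \<and> (\<forall>x n. act w (x + 4 * n) = act w x + 4 * (s * n))"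
proof (induction w)
  case (Cons y w)
  then obtain s where s: "s = 1 \<or> s = -1" "\<And>x n. act w (x + 4 * n) = act w x + 4 * (s * n)" by blast
  obtain i t where y: "y = (i, t)" by (cases y)
  show ?case
    by (rule exI[of _ "if i = 1 then - s else s"]) (use s(1) in \<open>auto simp: y s(2) letter_act_periodic\<close>)
qed auto

lemma act_wpow: "act (w \<up> n) = act w ^^ n"
  by (induction n) (simp_all add: wpow_def)

text \<open>For translations this is congruence modulo the vectors of sum zero in k Z^4 + h Z
  (1,1,1,1). For k = h = 0 it is equality of functions.\<close>

definition act_eq :: "int \<Rightarrow> int \<Rightarrow> (int \<Rightarrow> int) \<Rightarrow> (int \<Rightarrow> int) \<Rightarrow> bool" where
  "act_eq k h f g \<longleftrightarrow> (\<exists>t. \<forall>x. 4 * k dvd f x - g x - 4 * h * t)"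

lemma act_eq_refl [simp]: "act_eq k h f f"
  unfolding act_eq_def by (rule exI[of _ 0]) simp

lemma act_eq_sym: "act_eq k h f g \<Longrightarrow> act_eq k h g f"
  unfolding act_eq_def
proof (elim exE)
  fix t assume *: "\<forall>x. 4 * k dvd f x - g x - 4 * h * t"
  have "4 * k dvd - (f x - g x - 4 * h * t)" for x using * by (simp only: dvd_minus_iff)
  then show "\<exists>t. \<forall>x. 4 * k dvd g x - f x - 4 * h * t"
    by (intro exI[of _ "- t"]) (simp add: algebra_simps)
qed

lemma act_eq_trans: "act_eq k h f g \<Longrightarrow> act_eq k h g l \<Longrightarrow> act_eq k h f l"
  unfolding act_eq_def
proof (elim exE)
  fix t t' assume *: "\<forall>x. 4 * k dvd f x - g x - 4 * h * t" "\<forall>x. 4 * k dvd g x - l x - 4 * h * t'"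
  have "4 * k dvd (f x - g x - 4 * h * t) + (g x - l x - 4 * h * t')" for x using * by (simp only: dvd_add)
  then show "\<exists>t. \<forall>x. 4 * k dvd f x - l x - 4 * h * t"
    by (intro exI[of _ "t + t'"]) (simp add: algebra_simps)
qed

text \<open>A discrepancy 4n in the argument of the action of a word reappears as 4sn with a sign s
  independent of the point, so constant discrepancies stay constant. The outer map f is therefore
  required to be such an action.\<close>

lemma act_eq_comp:
  assumes "act_eq k h f f'" "act_eq k h (act v) (act v')" "f = act u"
  shows "act_eq k h (f \<circ> act v) (f' \<circ> act v')"
proof -
  obtain t where t: "\<And>x. 4 * k dvd f x - f' x - 4 * h * t"
    using assms(1) unfolding act_eq_def by blast
  obtain t' where t': "\<And>x. 4 * k dvd act v x - act v' x - 4 * h * t'"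
    using assms(2) unfolding act_eq_def by blast
  obtain s where s: "\<And>x n. f (x + 4 * n) = f x + 4 * (s * n)"
    using act_periodic[of u] assms(3) by blast
  have "4 * k dvd f (act v x) - f' (act v' x) - 4 * h * (t + s * t')" for x
  proof -
    obtain n where n: "act v x = act v' x + 4 * (h * t' + k * n)"
      using t'[of x] by (auto simp: dvd_def algebra_simps)
    have "f (act v x) = f (act v' x) + 4 * (s * (h * t' + k * n))"
      unfolding n by (rule s)
    then have eq: "f (act v x) - f' (act v' x) - 4 * h * (t + s * t') =
        (f (act v' x) - f' (act v' x) - 4 * h * t) + 4 * k * (s * n)"
      by (simp add: algebra_simps)
    show ?thesis unfolding eq by (rule dvd_add[OF t dvd_triv_left])
  qed
  then show ?thesis unfolding act_eq_def by auto
qed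

lemma act_eq_append:
  "act_eq k h (act u) (act u') \<Longrightarrow> act_eq k h (act v) (act v') \<Longrightarrow> act_eq k h (act (u @ v)) (act (u' @ v'))"
  using act_eq_comp[of k h "act u" "act u'" v v' u] by simp

lemma act_eq_mono:
  assumes "act_eq k h f g" "k' dvd k" "h' dvd h"
  shows "act_eq k' h' f g"
proof -
  obtain t where t: "\<And>x. 4 * k dvd f x - g x - 4 * h * t"
    using assms(1) unfolding act_eq_def by blast
  obtain q where q: "h = h' * q" using assms(3) by blast
  have "4 * k' dvd f x - g x - 4 * h' * (q * t)" for x
    using dvd_trans[OF _ t[of x], of "4 * k'"] assms(2) by (simp add: q mult.assoc)
  then show ?thesis unfolding act_eq_def by blast
qed

lemma pres_eq_act_eq:
  assumes "pres_eq X R u v" "\<And>r. r \<in> R \<Longrightarrow> act_eq k h (act r) id"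
  shows "act_eq k h (act u) (act v)"
  using assms(1)
proof (induction rule: pres_eq.induct)
  case (cancel x b)
  then show ?case by (simp add: fun_eq_iff comp_def id_def)
next
  case (relator r)
  then show ?case using assms(2) by (simp only: act_Nil)
qed (auto intro: act_eq_sym act_eq_trans act_eq_append simp del: act_append)

text \<open>The affine permutation that corresponds to \<open>tr i j k\<close>; the coordinate at
  residue 0 makes the vector have sum zero.\<close>

definition shift :: "int \<Rightarrow> int \<Rightarrow> int \<Rightarrow> int \<Rightarrow> int" where
  "shift i j k x = x + 4 * (if x mod 4 = 1 then i else if x mod 4 = 2 then j else if x mod 4 = 3 then k else - i - j - k)"

lemma shift_0 [simp]: "shift 0 0 0 = id"
  by (simp add: shift_def fun_eq_iff)

lemma shift_comp: "shift i j k \<circ> shift i' j' k' = shift (i + i') (j + j') (k + k')"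
  by (simp add: shift_def fun_eq_iff)

lemma shift_pow: "shift i j k ^^ n = shift (int n * i) (int n * j) (int n * k)"
  by (induction n) (simp_all add: shift_comp algebra_simps)

text \<open>By periodicity, the values at 0 to 3 determine the action once the sign of the period is
  known; the value at 4 forces that sign to be 1.\<close>

lemma act_eqI:
  assumes "act u 0 = shift i j k 0" "act u 1 = shift i j k 1" "act u 2 = shift i j k 2"
    "act u 3 = shift i j k 3" "act u 4 = shift i j k 4"
  shows "act u = shift i j k"
proof
  fix x :: int
  obtain s where s: "s = 1 \<or> s = -1" "\<And>x n. act u (x + 4 * n) = act u x + 4 * (s * n)"
    using act_periodic[of u] by blast
  have s1: "s = 1" using s(2)[of 0 1] assms(1,5) s(1) by (auto simp: shift_def)
  define r where "r = x mod 4"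
  have x: "x = r + 4 * (x div 4)" by (simp add: r_def)
  have "act u r = shift i j k r"
    using residues_4[of x] assms(1-4) unfolding r_def by auto
  moreover have "shift i j k (r + 4 * (x div 4)) = shift i j k r + 4 * (x div 4)"
    by (simp add: shift_def)
  ultimately show "act u x = shift i j k x"
    using s(2)[of r "x div 4"] x s1 by simp
qed

section \<open>Words for the normal forms and their actions\<close>

definition rword :: "nat list \<Rightarrow> nat word" where
  "rword = map (\<lambda>i. (i, True))"

definition x1w :: "nat word" where "x1w = rword [1,0,1,0,1,2,1,2,1,2,1,0]"
definition x2w :: "nat word" where "x2w = rword [0,1,0,1,0,1,2,1,2,1,2,1,0,0]"
definition x3w :: "nat word" where "x3w = rword [1,2,1,0,1,0,1,0,1,2,1,2,1,2,1,0,0,1,2,1]"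

definition zpow :: "nat word \<Rightarrow> int \<Rightarrow> nat word" where
  "zpow w n = (if n < 0 then winv w \<up> nat (- n) else w \<up> nat n)"

definition trw :: "int \<Rightarrow> int \<Rightarrow> int \<Rightarrow> nat word" where
  "trw i j k = zpow x1w i @ zpow x2w j @ zpow x3w k"

definition cword :: "nat list \<Rightarrow> nat word" where
  "cword u = concat (map (\<lambda>i. rword (if i = 0 then [0] else if i = 1 then [1,2,1] else [2])) u)"

definition nf :: "int \<times> int \<times> int \<times> nat list \<times> nat \<Rightarrow> nat word" where
  "nf = (\<lambda>(i, j, k, u, e). trw i j k @ cword u @ rword [1] \<up> e)"

lemma act_xw: "act x1w = shift 1 0 0" "act x2w = shift 0 1 0" "act x3w = shift 0 0 1"
  by (rule act_eqI; simp add: x1w_def x2w_def x3w_def rword_def letter_act_def shift_def)+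

lemma act_zpow:
  assumes "act w = shift i j k"
  shows "act (zpow w n) = shift (n * i) (n * j) (n * k)"
proof -
  have "act (winv w) x = shift (- i) (- j) (- k) x" for x
  proof -
    have "act w (shift (- i) (- j) (- k) x) = x"
      using shift_comp[of i j k "- i" "- j" "- k"] by (simp add: assms fun_eq_iff)
    then show ?thesis using act_winv(1)[of w "shift (- i) (- j) (- k) x"] by simp
  qed
  then have "act (winv w) = shift (- i) (- j) (- k)" by auto
  then show ?thesis by (simp add: zpow_def act_wpow assms shift_pow)
qed

lemma act_trw: "act (trw i j k) = shift i j k"
  by (simp add: trw_def act_zpow[OF act_xw(1)] act_zpow[OF act_xw(2)] act_zpow[OF act_xw(3)] shift_comp)

section \<open>Separation of the normal forms\<close>

definition corner :: "nat list \<Rightarrow> int list" where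
  "corner u = map (act (cword u)) [1, 2, 3, 4]"

lemma cword_simps: "cword [] = []"
  "cword (i # u) = rword (if i = 0 then [0] else if i = 1 then [1,2,1] else [2]) @ cword u"
  by (simp_all add: cword_def)

lemma distinct_corners: "distinct (map corner perms)"
  by (simp add: perms_def corner_def cword_simps rword_def letter_act_def)

lemma inj_corner: "inj_on corner (set perms)"
  using distinct_corners by (simp add: distinct_map)

lemma corner_range:
  assumes "u \<in> set perms" "x \<in> {1, 2, 3, 4}"
  shows "act (cword u) x \<in> {1, 2, 3, 4}"
proof -
  have "\<forall>u\<in>set perms. \<forall>x\<in>{1,2,3,4}. act (cword u) x \<in> {1, 2, 3, 4}"
    by (simp add: perms_def cword_simps rword_def letter_act_def)
  with assms show ?thesis by blast
qed

definition corner_sum :: "(int \<Rightarrow> int) \<Rightarrow> int" where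
  "corner_sum f = f 1 + f 2 + f 3 + f 4"

lemma corner_sum_shift:
  assumes "u \<in> set perms"
  shows "corner_sum (shift i j k \<circ> act (cword u)) = 10"
proof -
  have "\<forall>u\<in>set perms. corner_sum (shift i j k \<circ> act (cword u)) = 10"
    by (simp add: perms_def cword_simps rword_def letter_act_def corner_sum_def shift_def)
  with assms show ?thesis by blast
qed

text \<open>The corner sum modulo 8 detects the parity of the number of letters \<open>b\<close>, because 8 divides
  \<open>4k\<close> and \<open>16h\<close>.\<close>

lemma corner_sum_swap: "8 dvd corner_sum (act w \<circ> letter_act 1) - corner_sum (act w) - 4"
proof -
  obtain s where s: "s = 1 \<or> s = -1" "\<And>x n. act w (x + 4 * n) = act w x + 4 * (s * n)"
    using act_periodic[of w] by blast
  have "act w 5 = act w 1 + 4 * s" using s(2)[of 1 1] by simp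
  then show ?thesis using s(1) by (auto simp: corner_sum_def letter_act_def)
qed

lemma corner_sum_act_eq:
  assumes "act_eq k h f g" "2 dvd k" "k dvd 4 * h"
  shows "8 dvd corner_sum f - corner_sum g"
proof -
  obtain t where t: "\<And>x. 4 * k dvd f x - g x - 4 * h * t"
    using assms(1) unfolding act_eq_def by blast
  have d: "8 dvd 4 * k" using assms(2) by auto
  have "8 dvd 4 * (4 * h)" using dvd_trans[OF d mult_dvd_mono[OF dvd_refl assms(3)]] .
  then have "8 dvd 4 * (4 * h) * t" by (rule dvd_mult2)
  moreover have "8 dvd (f 1 - g 1 - 4 * h * t) + (f 2 - g 2 - 4 * h * t) + (f 3 - g 3 - 4 * h * t) + (f 4 - g 4 - 4 * h * t)"
    by (intro dvd_add dvd_trans[OF d t])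
  ultimately have "8 dvd ((f 1 - g 1 - 4 * h * t) + (f 2 - g 2 - 4 * h * t) + (f 3 - g 3 - 4 * h * t) + (f 4 - g 4 - 4 * h * t))
      + 4 * (4 * h) * t" by (rule dvd_add[rotated])
  then show ?thesis by (simp add: corner_sum_def algebra_simps)
qed

lemma act_nf: "act (nf (i, j, k, u, e)) = shift i j k \<circ> act (cword u) \<circ> act (rword [1] \<up> e)"
  by (simp add: nf_def act_trw comp_assoc)

lemma corner_sum_nf:
  assumes "u \<in> set perms" "e < 2"
  shows "8 dvd corner_sum (act (nf (i, j, k, u, e))) - 10 - 4 * int e"
proof (cases "e = 0")
  case True
  then show ?thesis using corner_sum_shift[OF assms(1), of i j k] by (simp add: act_nf wpow_def)
next
  case False
  with assms(2) have "e = 1" by simp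
  then show ?thesis
    using corner_sum_swap[of "trw i j k @ cword u"] corner_sum_shift[OF assms(1), of i j k]
    by (simp add: act_nf wpow_def rword_def act_trw comp_assoc)
qed

lemma act_eq_cancel:
  assumes "act_eq k h (f \<circ> act v) (g \<circ> act v)"
  shows "act_eq k h f g"
proof -
  obtain t where "\<And>x. 4 * k dvd f (act v x) - g (act v x) - 4 * h * t"
    using assms unfolding act_eq_def by auto
  from this[of "act (winv v) _"] show ?thesis
    unfolding act_eq_def by (auto simp: act_winv)
qed

text \<open>The action is read three times: the corner sum modulo 8 gives e, the residues modulo 4
  give u, and the values modulo 4k then give the translation.\<close>

lemma nf_unique:
  assumes "act_eq k h (act (nf (i, j, l, u, e))) (act (nf (i', j', l', u', e')))"
    and u: "u \<in> set perms" "u' \<in> set perms" and e: "e < 2" "e' < 2"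
    and kh: "2 dvd k" "k dvd 4 * h"
  shows "u = u' \<and> e = e' \<and> (\<exists>t. k dvd i - i' - h * t \<and> k dvd j - j' - h * t \<and> k dvd l - l' - h * t)"
proof -
  have "8 dvd 4 * int e - 4 * int e'"
    using corner_sum_act_eq[OF assms(1) kh] corner_sum_nf[OF u(1) e(1), of i j l]
      corner_sum_nf[OF u(2) e(2), of i' j' l'] by presburger
  with e have ee: "e = e'" by presburger
  have "act_eq k h (shift i j l \<circ> act (cword u)) (shift i' j' l' \<circ> act (cword u'))"
    using assms(1) unfolding act_nf ee by (rule act_eq_cancel)
  then obtain t where t: "\<And>x. 4 * k dvd shift i j l (act (cword u) x) - shift i' j' l' (act (cword u') x) - 4 * h * t"
    unfolding act_eq_def by auto
  have "act (cword u) x = act (cword u') x" if "x \<in> {1, 2, 3, 4}" for x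
  proof -
    have "4 dvd shift i j l (act (cword u) x) - shift i' j' l' (act (cword u') x) - 4 * h * t"
      using dvd_mult_left[OF t] .
    moreover obtain q q' where "shift i j l (act (cword u) x) = act (cword u) x + 4 * q"
      "shift i' j' l' (act (cword u') x) = act (cword u') x + 4 * q'"
      unfolding shift_def by blast
    ultimately have "4 dvd (act (cword u) x + 4 * q - (act (cword u') x + 4 * q') - 4 * h * t) - 4 * (q - q' - h * t)"
      by (metis dvd_diff dvd_triv_left)
    then have "4 dvd act (cword u) x - act (cword u') x"
      by (simp add: algebra_simps)
    then show ?thesis
      using corner_range[OF u(1) that] corner_range[OF u(2) that] by auto
  qed
  then have "corner u = corner u'" by (simp add: corner_def)
  then have uu: "u = u'" using inj_corner u by (auto dest: inj_onD)
  \<comment> \<open>Evaluating at the preimage of y removes the common permutation.\<close>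
  have "4 * k dvd shift i j l y - shift i' j' l' y - 4 * h * t" for y
    using t[of "act (winv (cword u)) y"] by (simp add: uu act_winv)
  from this[of 1] this[of 2] this[of 3]
  have "4 * k dvd 4 * (i - i' - h * t)" "4 * k dvd 4 * (j - j' - h * t)" "4 * k dvd 4 * (l - l' - h * t)"
    by (simp_all add: shift_def algebra_simps)
  then have "k dvd i - i' - h * t" "k dvd j - j' - h * t" "k dvd l - l' - h * t"
    by (simp_all only: dvd_times_left_cancel_iff[of "4::int"] zero_neq_numeral[symmetric] not_False_eq_True)
  then show ?thesis using uu ee by blast
qed

section \<open>Groups presented by extensions of the relators\<close>

text \<open>Otherwise the simplifier rewrites the letter 1 to \<open>Suc 0\<close>.\<close>

declare One_nat_def [simp del]

definition letters :: "nat set" where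
  "letters = {0, 1, 2}"

lemma letters_iff [simp]: "i \<in> letters \<longleftrightarrow> i = 0 \<or> i = 1 \<or> i = 2"
  by (simp add: letters_def)

lemma pres_eq_mono:
  assumes "pres_eq X R u v" "R \<subseteq> S"
  shows "pres_eq X S u v"
  using assms(1) by (induction rule: pres_eq.induct) (use assms(2) in \<open>auto intro: pres_eq.intros\<close>)

lemma words_wpow [simp]: "w \<in> words X \<Longrightarrow> w \<up> n \<in> words X"
  by (induction n) (auto simp: wpow_def)

lemma words_rword [simp]: "rword u \<in> words X \<longleftrightarrow> set u \<subseteq> X"
  by (induction u) (auto simp: rword_def)

lemma words_cword [simp]: "cword u \<in> words letters"
  by (induction u) (auto simp: cword_simps)

lemma words_zpow [simp]: "w \<in> words X \<Longrightarrow> zpow w n \<in> words X"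
  by (simp add: zpow_def)

lemma words_nf [simp]: "nf t \<in> words letters"
  by (cases t) (auto simp: nf_def trw_def x1w_def x2w_def x3w_def)

lemma wpow_Suc: "w \<up> Suc n = w @ w \<up> n"
  by (simp add: wpow_def)

lemma wpow_numeral: "w \<up> 0 = []" "w \<up> 1 = w" "w \<up> numeral k = w @ w \<up> pred_numeral k"
  by (simp_all add: wpow_def numeral_eq_Suc One_nat_def)

lemma wpow_2: "w \<up> 2 = w @ w"
  by (simp add: wpow_def numeral_2_eq_2)

locale extension_66_3 =
  fixes S :: "nat word set"
  assumes rels_sub: "rels \<subseteq> S"
begin

definition Gp where "Gp = presented_group letters S"

definition cls where "cls w = pres_rel letters S `` {w}"

lemma cls_append: "u \<in> words letters \<Longrightarrow> v \<in> words letters \<Longrightarrow> cls (u @ v) = cls u \<otimes>\<^bsub>Gp\<^esub> cls v"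
  by (simp add: Gp_def cls_def)

lemma cls_eq_iff: "u \<in> words letters \<Longrightarrow> v \<in> words letters \<Longrightarrow> cls u = cls v \<longleftrightarrow> pres_eq letters S u v"
  by (simp add: cls_def pres_class_eq_iff)

lemma cls_Nil: "cls [] = \<one>\<^bsub>Gp\<^esub>"
  by (simp add: cls_def Gp_def pres_one)

lemma cls_closed: "w \<in> words letters \<Longrightarrow> cls w \<in> carrier Gp"
  by (simp add: cls_def Gp_def)

lemma carrier_Gp: "carrier Gp = cls ` words letters"
  by (auto simp: Gp_def cls_def elim!: pres_carrierE)

lemma cls_relator: "r \<in> S \<Longrightarrow> r \<in> words letters \<Longrightarrow> cls r = \<one>\<^bsub>Gp\<^esub>"
  by (simp add: cls_eq_iff pres_eq.relator flip: cls_Nil)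

sublocale Gp: group Gp
  unfolding Gp_def by (rule presented_group_is_group)

lemma cls_wpow: "w \<in> words letters \<Longrightarrow> cls (w \<up> n) = cls w [^]\<^bsub>Gp\<^esub> n"
proof (induction n)
  case (Suc n)
  then show ?case
    using Gp.nat_pow_Suc2[OF cls_closed] by (simp add: wpow_Suc cls_append)
qed (simp add: wpow_def cls_Nil)

lemma cls_winv: "w \<in> words letters \<Longrightarrow> cls (winv w) = inv\<^bsub>Gp\<^esub> cls w"
  by (rule Gp.inv_equality[symmetric])
    (simp_all add: cls_closed pres_eq_winv cls_eq_iff flip: cls_append cls_Nil)

lemma cls_zpow: "w \<in> words letters \<Longrightarrow> cls (zpow w n) = cls w [^]\<^bsub>Gp\<^esub> n"
  by (simp only: zpow_def int_pow_def2 if_distrib[of cls] cls_wpow cls_winv winv_words cls_closed Gp.nat_pow_inv)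

sublocale group_66_3 Gp "cls r0" "cls r1" "cls r2"
proof unfold_locales
  have rel: "cls (w \<up> n) = \<one>\<^bsub>Gp\<^esub>" if "w \<up> n \<in> rels" "w \<in> words letters" for w n
    using that rels_sub by (intro cls_relator) auto
  show cl: "cls r0 \<in> carrier Gp" "cls r1 \<in> carrier Gp" "cls r2 \<in> carrier Gp"
    by (simp_all add: cls_closed)
  show inv: "cls r0 \<otimes>\<^bsub>Gp\<^esub> cls r0 = \<one>\<^bsub>Gp\<^esub>" "cls r1 \<otimes>\<^bsub>Gp\<^esub> cls r1 = \<one>\<^bsub>Gp\<^esub>"
    "cls r2 \<otimes>\<^bsub>Gp\<^esub> cls r2 = \<one>\<^bsub>Gp\<^esub>"
    using rel[of r0 2] rel[of r1 2] rel[of r2 2] cls_append[of r0 r0] cls_append[of r1 r1] cls_append[of r2 r2]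
    by (simp_all add: rels_def wpow_2)
  show "(cls r0 \<otimes>\<^bsub>Gp\<^esub> cls r1) [^]\<^bsub>Gp\<^esub> (6::nat) = \<one>\<^bsub>Gp\<^esub>"
    using rel[of "r0 @ r1" 6] cls_wpow[of "r0 @ r1" 6] cls_append[of r0 r1] by (simp add: rels_def)
  show "(cls r1 \<otimes>\<^bsub>Gp\<^esub> cls r2) [^]\<^bsub>Gp\<^esub> (6::nat) = \<one>\<^bsub>Gp\<^esub>"
    using rel[of "r1 @ r2" 6] cls_wpow[of "r1 @ r2" 6] cls_append[of r1 r2] by (simp add: rels_def)
  show "(cls r2 \<otimes>\<^bsub>Gp\<^esub> cls r1 \<otimes>\<^bsub>Gp\<^esub> cls r0 \<otimes>\<^bsub>Gp\<^esub> cls r1) [^]\<^bsub>Gp\<^esub> (3::nat) = \<one>\<^bsub>Gp\<^esub>"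
    using rel[of "r2 @ r1 @ r0 @ r1" 3] cls_wpow[of "r2 @ r1 @ r0 @ r1" 3] cls_append[of r2 "r1 @ r0 @ r1"]
      cls_append[of r1 "r0 @ r1"] cls_append[of r0 r1] by (simp add: rels_def Gp.m_assoc cl)
  have "cls ((r0 @ r2) \<up> 2) = (cls r0 \<otimes>\<^bsub>Gp\<^esub> cls r2) \<otimes>\<^bsub>Gp\<^esub> (cls r0 \<otimes>\<^bsub>Gp\<^esub> cls r2)"
    using cls_append[of "r0 @ r2" "r0 @ r2"] cls_append[of r0 r2] by (simp add: wpow_2)
  then have "(cls r0 \<otimes>\<^bsub>Gp\<^esub> cls r2) \<otimes>\<^bsub>Gp\<^esub> (cls r0 \<otimes>\<^bsub>Gp\<^esub> cls r2) = \<one>\<^bsub>Gp\<^esub>"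
    using rel[of "r0 @ r2" 2] by (simp add: rels_def)
  then have "cls r0 \<otimes>\<^bsub>Gp\<^esub> cls r2 = inv\<^bsub>Gp\<^esub> (cls r0 \<otimes>\<^bsub>Gp\<^esub> cls r2)"
    using Gp.inv_equality[of "cls r0 \<otimes>\<^bsub>Gp\<^esub> cls r2"] cl by simp
  also have "\<dots> = cls r2 \<otimes>\<^bsub>Gp\<^esub> cls r0"
    using Gp.inv_equality[OF inv(1)] Gp.inv_equality[OF inv(3)] cl by (simp add: Gp.inv_mult_group)
  finally show "cls r0 \<otimes>\<^bsub>Gp\<^esub> cls r2 = cls r2 \<otimes>\<^bsub>Gp\<^esub> cls r0" .
qed

lemma cls_letter:
  assumes "i \<in> letters"
  shows "cls [(i, s)] = (if i = 0 then cls r0 else if i = 1 then cls r1 else cls r2)"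
proof -
  have "cls [(i, True)] \<otimes>\<^bsub>Gp\<^esub> cls [(i, True)] = \<one>\<^bsub>Gp\<^esub>"
    using assms invol by auto
  moreover have "cls [(i, False)] \<otimes>\<^bsub>Gp\<^esub> cls [(i, True)] = \<one>\<^bsub>Gp\<^esub>"
    using assms pres_eq.cancel[of i "letters" S False]
      cls_eq_iff[of "[(i, False), (i, True)]" "[]"] cls_append[of "[(i, False)]" "[(i, True)]"]
    by (auto simp: cls_Nil)
  ultimately have "cls [(i, False)] = cls [(i, True)]"
    using assms Gp.right_cancel cls_closed by (metis words_Cons words_Nil)
  then have "cls [(i, s)] = cls [(i, True)]" by (cases s) auto
  then show ?thesis using assms by auto
qed

lemma cls_val: "w \<in> words letters \<Longrightarrow> cls w = val w"
proof (induction w)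
  case (Cons x w)
  obtain i s where x: "x = (i, s)" by (cases x)
  then have "cls (x # w) = cls [(i, s)] \<otimes>\<^bsub>Gp\<^esub> val w"
    using Cons cls_append[of "[(i, s)]" w] by simp
  then show ?case using Cons.prems cls_letter[of i s] by (simp add: x val_def)
qed (simp add: val_def cls_Nil)

lemma cls_trw: "cls (trw i j k) = tr i j k"
proof -
  have w: "x1w \<in> words letters" "x2w \<in> words letters" "x3w \<in> words letters"
    by (simp_all add: x1w_def x2w_def x3w_def)
  have "cls x1w = x1" "cls x2w = x2" "cls x3w = x3"
    by (simp_all add: cls_val[OF w(1)] cls_val[OF w(2)] cls_val[OF w(3)])
      (simp_all add: val_def x1w_def x2w_def x3w_def x1_def x2_def x3_def rword_def d_def p_def Gp.m_assoc)
  then show ?thesis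
    by (simp add: trw_def cls_append w cls_zpow tr_def Gp.m_assoc)
qed

lemma cls_cword: "cls (cword u) = cval u"
proof (induction u)
  case (Cons i u)
  have "cls (rword [0]) = cls r0" "cls (rword [2]) = cls r2"
    by (simp_all add: rword_def)
  moreover have "cls (rword [1, 2, 1]) = p"
    using cls_val[of "rword [1, 2, 1]"] by (simp add: val_def rword_def p_def)
  ultimately show ?case
    using Cons by (simp add: cval_Cons cword_simps cls_append cgen_def)
qed (simp add: cval_def cword_simps cls_Nil)

lemma cls_nf: "cls (nf (i, j, k, u, e)) = tr i j k \<otimes>\<^bsub>Gp\<^esub> cval u \<otimes>\<^bsub>Gp\<^esub> cls r1 [^]\<^bsub>Gp\<^esub> e"
proof -
  have "trw i j k \<in> words letters"
    by (simp add: trw_def x1w_def x2w_def x3w_def)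
  moreover have "cls (rword [1]) = cls r1"
    by (simp add: rword_def)
  ultimately show ?thesis
    by (simp add: nf_def cls_append cls_trw cls_cword cls_wpow Gp.m_assoc)
qed

lemma cls_normal_form:
  assumes "w \<in> words letters"
  shows "\<exists>i j k u e. u \<in> set perms \<and> e < 2 \<and> cls w = cls (nf (i, j, k, u, e))"
proof -
  obtain i j k u e where n: "u \<in> set perms" "e < 2"
    "val w = tr i j k \<otimes>\<^bsub>Gp\<^esub> cval u \<otimes>\<^bsub>Gp\<^esub> cls r1 [^]\<^bsub>Gp\<^esub> (e::nat)"
    using val_normal_form[of w] by metis
  then have "cls w = cls (nf (i, j, k, u, e))"
    by (simp only: cls_nf cls_val[OF assms])
  then show ?thesis using n(1,2) by blast
qed

end

lemma act_rels: "r \<in> rels \<Longrightarrow> act r = id"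
proof -
  have "act ((r0 @ r1) \<up> 6) = shift 0 0 0" "act ((r1 @ r2) \<up> 6) = shift 0 0 0" "act ((r0 @ r2) \<up> 2) = shift 0 0 0"
    "act ((r2 @ r1 @ r0 @ r1) \<up> 3) = shift 0 0 0" "act (r0 \<up> 2) = shift 0 0 0" "act (r1 \<up> 2) = shift 0 0 0"
    "act (r2 \<up> 2) = shift 0 0 0"
    by (rule act_eqI; simp add: wpow_numeral letter_act_def shift_def)+
  then show "r \<in> rels \<Longrightarrow> act r = id" by (auto simp: rels_def)
qed

interpretation base: extension_66_3 rels
  by unfold_locales simp

text \<open>The normal form of w acts as that of \<open>trw i j k\<close>, and uniqueness identifies
  them. An added relator can thus be evaluated from its action alone, without rewriting in the
  group.\<close>

lemma pres_eq_translation: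
  assumes "w \<in> words letters" "act w = shift i j k"
  shows "pres_eq letters rels w (trw i j k)"
proof -
  obtain i' j' k' u e where n: "u \<in> set perms" "e < 2" "pres_eq letters rels w (nf (i', j', k', u, e))"
    using base.cls_normal_form[OF assms(1)] base.cls_eq_iff[OF assms(1)] by auto
  \<comment> \<open>The parameters 0, 0 make congruence an equality, so the exponents are determined
    exactly.\<close>
  have "act_eq 0 0 (act w) (act (nf (i', j', k', u, e)))"
    by (rule pres_eq_act_eq[OF n(3)]) (simp add: act_rels)
  moreover have "act w = act (nf (i, j, k, [], 0))"
    by (simp add: assms(2) act_nf cword_simps wpow_def)
  ultimately have "act_eq 0 0 (act (nf (i, j, k, [], 0))) (act (nf (i', j', k', u, e)))"
    by simp
  from nf_unique[OF this _ n(1) _ n(2)]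
  have "nf (i', j', k', u, e) = nf (i, j, k, [], 0)" by (auto simp: perms_def)
  also have "\<dots> = trw i j k" by (simp add: nf_def cword_simps wpow_def)
  finally show ?thesis using n(3) by simp
qed

lemma (in extension_66_3) cls_translation:
  assumes "w \<in> words letters" "act w = shift i j k"
  shows "cls w = tr i j k"
proof -
  have e: "pres_eq letters S w (trw i j k)"
    using pres_eq_translation[OF assms] rels_sub by (rule pres_eq_mono)
  then show ?thesis using cls_eq_iff[of w "trw i j k"] pres_eq_words[OF e] by (simp add: cls_trw)
qed

section \<open>Finite quotients: order and faithfulness\<close>

text \<open>The elements of a dihedral group of order 12 other than the identity and the two
  generators. The two alternating words of length 6 agree, so one of them is listed.\<close>

definition dih :: "nat \<Rightarrow> nat \<Rightarrow> nat list list" where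
  "dih i j = [[i, j], [j, i], [i, j, i], [j, i, j], [i, j, i, j], [j, i, j, i],
    [i, j, i, j, i], [j, i, j, i, j], [i, j, i, j, i, j]]"

text \<open>One word for each of the 23 elements of the subgroups generated by at most two
  generators.\<close>

definition parabolic_words :: "nat list list" where
  "parabolic_words = [[], [0], [1], [2], [0, 2]] @ dih 0 1 @ dih 1 2"

context group_66_3
begin

text \<open>The braid relations of a, d and of p, c, spelled in a, b, c: they bring alternating
  words just outside the list back into it.\<close>

lemma dihedral_long:
  shows "b \<otimes> (a \<otimes> (b \<otimes> (a \<otimes> (b \<otimes> a)))) = a \<otimes> (b \<otimes> (a \<otimes> (b \<otimes> (a \<otimes> b))))"
    "b \<otimes> (a \<otimes> (b \<otimes> (a \<otimes> (b \<otimes> (a \<otimes> b))))) = a \<otimes> (b \<otimes> (a \<otimes> (b \<otimes> a)))"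
    "c \<otimes> (b \<otimes> (c \<otimes> (b \<otimes> (c \<otimes> b)))) = b \<otimes> (c \<otimes> (b \<otimes> (c \<otimes> (b \<otimes> c))))"
    "c \<otimes> (b \<otimes> (c \<otimes> (b \<otimes> (c \<otimes> (b \<otimes> c))))) = b \<otimes> (c \<otimes> (b \<otimes> (c \<otimes> b)))"
proof -
  show 1: "b \<otimes> (a \<otimes> (b \<otimes> (a \<otimes> (b \<otimes> (a \<otimes> b))))) = a \<otimes> (b \<otimes> (a \<otimes> (b \<otimes> a)))"
    using braid_ad by (simp add: d_def m_assoc)
  then show "b \<otimes> (a \<otimes> (b \<otimes> (a \<otimes> (b \<otimes> a)))) = a \<otimes> (b \<otimes> (a \<otimes> (b \<otimes> (a \<otimes> b))))"
    by (simp flip: 1)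
  show 2: "c \<otimes> (b \<otimes> (c \<otimes> (b \<otimes> (c \<otimes> b)))) = b \<otimes> (c \<otimes> (b \<otimes> (c \<otimes> (b \<otimes> c))))"
    using arg_cong[OF braid_pc, of "\<lambda>z. z \<otimes> b"] by (simp add: p_def m_assoc)
  have "c \<otimes> (b \<otimes> (c \<otimes> (b \<otimes> (c \<otimes> (b \<otimes> c))))) = c \<otimes> (c \<otimes> (b \<otimes> (c \<otimes> (b \<otimes> (c \<otimes> b)))))"
    by (simp only: 2)
  then show "c \<otimes> (b \<otimes> (c \<otimes> (b \<otimes> (c \<otimes> (b \<otimes> c))))) = b \<otimes> (c \<otimes> (b \<otimes> (c \<otimes> b)))"
    by simp
qed

text \<open>The control over the letters of v is what later keeps the product in the same parabolic
  subgroup.\<close>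

lemma parabolic_words_step:
  assumes "u \<in> set parabolic_words" "i \<in> {0,1,2}" "\<not> {0,1,2} \<subseteq> insert i (set u)"
  shows "\<exists>v\<in>set parabolic_words. set v \<subseteq> insert i (set u) \<and> val (rword (i # u)) = val (rword v)"
proof -
  have "\<forall>u\<in>set parabolic_words. \<forall>i\<in>{0,1,2}. \<not> {0,1,2} \<subseteq> insert i (set u) \<longrightarrow>
    (\<exists>v\<in>set parabolic_words. set v \<subseteq> insert i (set u) \<and> val (rword (i # u)) = val (rword v))"
    by (simp add: parabolic_words_def dih_def rword_def val_def cox_base(1) cox_base_tail(1) dihedral_long)
  from this[THEN bspec, OF assms(1), THEN bspec, OF assms(2), THEN mp, OF assms(3)]
  show ?thesis .
qed

end

text \<open>The vectors in \<open>tr_lattice\<close> form a triangular basis of a lattice of index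
  \<open>h k\<^sup>2\<close>. As k divides 4h, the vector (h, h, h, -3h) is congruent to (h, h, h,
  h) modulo k; evenness of k supports the invariants modulo 8.\<close>

locale torus_66_3 = extension_66_3 +
  fixes k h :: int
  assumes k_pos: "0 < k" and h_pos: "0 < h" and h_dvd: "h dvd k" and k_even: "2 dvd k" and k_dvd: "k dvd 4 * h"
    and act_relators: "\<And>r. r \<in> S \<Longrightarrow> act_eq k h (act r) id"
    and tr_lattice: "tr h h h = \<one>\<^bsub>Gp\<^esub>" "tr 0 k 0 = \<one>\<^bsub>Gp\<^esub>" "tr 0 0 k = \<one>\<^bsub>Gp\<^esub>"
begin

text \<open>The vector (h, h, h) reduces the first coordinate modulo h and changes the other two by
  the same amount; these are then reduced modulo k.\<close>

lemma tr_reduce: "\<exists>i'\<in>{0..<h}. \<exists>j'\<in>{0..<k}. \<exists>l'\<in>{0..<k}. tr i j l = tr i' j' l'"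
proof -
  define q where "q = i div h"
  define j' where "j' = j - h * q"
  define l' where "l' = l - h * q"
  have one: "tr h h h [^]\<^bsub>Gp\<^esub> q = \<one>\<^bsub>Gp\<^esub>" "tr 0 k 0 [^]\<^bsub>Gp\<^esub> (j' div k) = \<one>\<^bsub>Gp\<^esub>"
    "tr 0 0 k [^]\<^bsub>Gp\<^esub> (l' div k) = \<one>\<^bsub>Gp\<^esub>"
    by (simp_all only: tr_lattice Gp.int_pow_one)
  have "tr i j l = tr h h h [^]\<^bsub>Gp\<^esub> q \<otimes>\<^bsub>Gp\<^esub> tr 0 k 0 [^]\<^bsub>Gp\<^esub> (j' div k)
      \<otimes>\<^bsub>Gp\<^esub> tr 0 0 k [^]\<^bsub>Gp\<^esub> (l' div k) \<otimes>\<^bsub>Gp\<^esub> tr (i mod h) (j' mod k) (l' mod k)"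
    by (simp add: tr_int_pow tr_mult) (simp add: q_def j'_def l'_def algebra_simps)
  then have "tr i j l = tr (i mod h) (j' mod k) (l' mod k)"
    unfolding one by simp
  then show ?thesis
    using k_pos h_pos by (intro bexI) auto
qed

definition nf_set :: "(int \<times> int \<times> int \<times> nat list \<times> nat) set" where
  "nf_set = {0..<h} \<times> {0..<k} \<times> {0..<k} \<times> set perms \<times> {0..<2}"

lemma cls_nf_set:
  assumes "w \<in> words letters"
  shows "\<exists>t\<in>nf_set. cls w = cls (nf t)"
proof -
  obtain i j l u e where n: "u \<in> set perms" "e < 2" "cls w = cls (nf (i, j, l, u, e))"
    using cls_normal_form[OF assms] by blast
  obtain i' j' l' where "i' \<in> {0..<h}" "j' \<in> {0..<k}" "l' \<in> {0..<k}" "tr i j l = tr i' j' l'"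
    using tr_reduce by blast
  with n have "cls w = cls (nf (i', j', l', u, e))" "(i', j', l', u, e) \<in> nf_set"
    by (simp_all add: cls_nf nf_set_def)
  then show ?thesis by blast
qed

lemma nf_set_unique:
  assumes "act_eq k h (act (nf t)) (act (nf t'))" "t \<in> nf_set" "t' \<in> nf_set"
  shows "t = t'"
proof -
  obtain i j l u e i' j' l' u' e' where t: "t = (i, j, l, u, e)" "t' = (i', j', l', u', e')"
    by (metis prod_cases5)
  have r: "u \<in> set perms" "u' \<in> set perms" "e < 2" "e' < 2" "0 \<le> i" "i < h" "0 \<le> i'" "i' < h"
    "0 \<le> j" "j < k" "0 \<le> j'" "j' < k" "0 \<le> l" "l < k" "0 \<le> l'" "l' < k"
    using assms(2,3) by (auto simp: t nf_set_def)
  obtain s where s: "u = u'" "e = e'" "k dvd i - i' - h * s" "k dvd j - j' - h * s" "k dvd l - l' - h * s"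
    using nf_unique[OF assms(1)[unfolded t] r(1-4) k_even k_dvd] by blast
  \<comment> \<open>Because h divides k, the first congruence determines i. It then reads
    \<open>k dvd h * s\<close>, so the common correction disappears from the other two.\<close>
  have "h dvd (i - i' - h * s) + h * s"
    using dvd_trans[OF h_dvd s(3)] by (rule dvd_add) simp
  then have "h dvd i - i'" by simp
  then have i: "i = i'" using r by (metis mod_eq_dvd_iff mod_pos_pos_trivial)
  then have ks: "k dvd h * s" using s(3) by simp
  have "k dvd j - j'" "k dvd l - l'"
    using dvd_add[OF s(4) ks] dvd_add[OF s(5) ks] by simp_all
  then have "j = j'" "l = l'" using r by (metis mod_eq_dvd_iff mod_pos_pos_trivial)+
  then show ?thesis using i s t by simp
qed

lemma cls_eq_imp_act_eq:
  assumes "u \<in> words letters" "v \<in> words letters" "cls u = cls v"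
  shows "act_eq k h (act u) (act v)"
  using assms pres_eq_act_eq[OF _ act_relators] by (simp add: cls_eq_iff)

text \<open>Faithfulness of the action: the reduced normal forms of u and v act congruently and
  hence coincide.\<close>

lemma act_eq_imp_cls_eq:
  assumes "u \<in> words letters" "v \<in> words letters" "act_eq k h (act u) (act v)"
  shows "cls u = cls v"
proof -
  obtain s t where st: "s \<in> nf_set" "cls u = cls (nf s)" "t \<in> nf_set" "cls v = cls (nf t)"
    using cls_nf_set assms(1,2) by meson
  then have "act_eq k h (act u) (act (nf s))" "act_eq k h (act v) (act (nf t))"
    using cls_eq_imp_act_eq assms(1,2) words_nf by blast+
  with assms(3) have "act_eq k h (act (nf s)) (act (nf t))"
    by (meson act_eq_sym act_eq_trans)
  then show ?thesis using nf_set_unique st by metis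
qed

lemma order_Gp: "int (order Gp) = 48 * h * k\<^sup>2"
proof -
  have "bij_betw (cls \<circ> nf) nf_set (carrier Gp)"
    unfolding bij_betw_def
  proof
    show "inj_on (cls \<circ> nf) nf_set"
      using cls_eq_imp_act_eq[OF words_nf words_nf] nf_set_unique by (auto simp: inj_on_def)
    show "(cls \<circ> nf) ` nf_set = carrier Gp"
      using cls_nf_set by (force simp: carrier_Gp)
  qed
  then have "order Gp = card nf_set"
    by (simp add: order_def bij_betw_same_card)
  also have "\<dots> = nat h * (nat k * (nat k * (card (set perms) * 2)))"
    by (simp add: nf_set_def card_cartesian_product)
  also have "card (set perms) = 24"
    using distinct_card[of perms] distinct_corners[unfolded distinct_map] by (simp add: perms_def)
  finally show ?thesis
    using k_pos h_pos by (simp add: power2_eq_square)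
qed

end

definition base_values :: "nat list \<Rightarrow> int list" where
  "base_values u = map (act (rword u)) [0, 1, 2, 3]"

lemma base_values_simps: "base_values [] = [0, 1, 2, 3]"
  "base_values (i # u) = map (letter_act i) (base_values u)"
  by (simp_all add: base_values_def rword_def)

text \<open>For even k, congruent actions differ modulo 8 by a constant multiple of 4; the first
  value modulo 4 and the differences modulo 8 are blind to it.\<close>

definition key :: "int list \<Rightarrow> int list" where
  "key xs = (hd xs mod 4) # map (\<lambda>y. (y - hd xs) mod 8) (tl xs)"

lemma key_cong:
  assumes "act_eq k h (act (rword u)) (act (rword v))" "2 dvd k"
  shows "key (base_values u) = key (base_values v)"
proof -
  have "act_eq 2 1 (act (rword u)) (act (rword v))" using assms by (rule act_eq_mono) simp
  then obtain t where t: "\<And>x. 8 dvd act (rword u) x - act (rword v) x - 4 * t"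
    unfolding act_eq_def by auto
  have "act (rword u) 0 mod 4 = act (rword v) 0 mod 4"
    using t[of 0] by presburger
  moreover have "(act (rword u) x - act (rword u) 0) mod 8 = (act (rword v) x - act (rword v) 0) mod 8" for x
    using dvd_diff[OF t[of x] t[of 0]] by (simp add: mod_eq_dvd_iff algebra_simps)
  ultimately show ?thesis by (simp add: key_def base_values_def)
qed

text \<open>A finite calculation modulo 8, independent of m, that serves all three families at
  once.\<close>

lemma distinct_keys: "distinct (map (\<lambda>u. key (base_values u)) parabolic_words)"
  by (simp add: parabolic_words_def dih_def base_values_simps key_def letter_act_def)

section \<open>Intersection property and type\<close>

context torus_66_3
begin

lemma parabolic_words_letters: "u \<in> set parabolic_words \<Longrightarrow> set u \<subseteq> letters"
proof -
  have "\<forall>u\<in>set parabolic_words. set u \<subseteq> letters"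
    by (simp add: parabolic_words_def dih_def)
  then show "u \<in> set parabolic_words \<Longrightarrow> set u \<subseteq> letters" by (rule bspec)
qed

lemma inj_cls_parabolic: "inj_on (\<lambda>u. cls (rword u)) (set parabolic_words)"
proof (rule inj_onI)
  fix u v assume uv: "u \<in> set parabolic_words" "v \<in> set parabolic_words" "cls (rword u) = cls (rword v)"
  then have "act_eq k h (act (rword u)) (act (rword v))"
    using cls_eq_imp_act_eq[OF _ _ uv(3)] parabolic_words_letters by simp
  then have "key (base_values u) = key (base_values v)"
    using k_even by (rule key_cong)
  then show "u = v"
    using distinct_keys uv(1,2) unfolding distinct_map by (blast dest: inj_onD)
qed

definition gen where "gen i = cls [(i, True)]"

lemma gen_closed: "i \<in> letters \<Longrightarrow> gen i \<in> carrier Gp"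
  by (simp add: gen_def cls_closed)

lemma generate_closed: "I \<subseteq> letters \<Longrightarrow> generate Gp (gen ` I) \<subseteq> carrier Gp"
  using gen_closed by (intro Gp.generate_incl) blast

definition parabolic where "parabolic I = (\<lambda>u. cls (rword u)) ` {u \<in> set parabolic_words. set u \<subseteq> I}"

lemma cls_rword_Cons:
  "i \<in> letters \<Longrightarrow> set u \<subseteq> letters \<Longrightarrow> cls (rword (i # u)) = gen i \<otimes>\<^bsub>Gp\<^esub> cls (rword u)"
  using cls_append[of "[(i, True)]" "rword u"] words_rword[of u letters] by (simp add: gen_def rword_def)

lemma cls_rword: "set u \<subseteq> letters \<Longrightarrow> cls (rword u) = val (rword u)"
  by (rule cls_val) simp

lemma parabolic_Cons:
  assumes "I \<subseteq> letters" "I \<noteq> letters" "i \<in> I" "z \<in> parabolic I"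
  shows "gen i \<otimes>\<^bsub>Gp\<^esub> z \<in> parabolic I"
proof -
  obtain u where u: "u \<in> set parabolic_words" "set u \<subseteq> I" "z = cls (rword u)"
    using assms(4) by (auto simp: parabolic_def)
  then have "\<not> letters \<subseteq> insert i (set u)" "i \<in> letters" "set u \<subseteq> letters"
    using assms(1-3) by auto
  with parabolic_words_step[of u i] u(1) obtain v
    where v: "v \<in> set parabolic_words" "set v \<subseteq> insert i (set u)" "val (rword (i # u)) = val (rword v)"
    by (auto simp: letters_def)
  have "set v \<subseteq> letters"
    using v(2) \<open>i \<in> letters\<close> \<open>set u \<subseteq> letters\<close> by blast
  then have "gen i \<otimes>\<^bsub>Gp\<^esub> z = cls (rword v)"
    using \<open>i \<in> letters\<close> \<open>set u \<subseteq> letters\<close> v(3) cls_rword[of "i # u"] cls_rword[of v]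
      cls_rword_Cons[of i u] by (simp add: u(3))
  moreover have "set v \<subseteq> I" using v(2) u(2) assms(3) by blast
  ultimately show ?thesis
    using v(1) unfolding parabolic_def by (intro image_eqI[of _ _ v]) simp_all
qed

lemma gen_sq: "i \<in> letters \<Longrightarrow> gen i \<otimes>\<^bsub>Gp\<^esub> gen i = \<one>\<^bsub>Gp\<^esub>"
  using invol by (auto simp: gen_def)

lemma inv_gen: "i \<in> letters \<Longrightarrow> inv\<^bsub>Gp\<^esub> gen i = gen i"
  by (intro Gp.inv_equality gen_sq gen_closed)

lemma cls_rword_generate:
  "set u \<subseteq> I \<Longrightarrow> I \<subseteq> letters \<Longrightarrow> cls (rword u) \<in> generate Gp (gen ` I)"
proof (induction u)
  case Nil
  then show ?case by (simp add: rword_def cls_Nil generate.one)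
next
  case (Cons i u)
  then have "cls (rword (i # u)) = gen i \<otimes>\<^bsub>Gp\<^esub> cls (rword u)"
    by (intro cls_rword_Cons) auto
  with Cons show ?case by (auto intro: generate.eng generate.incl)
qed

text \<open>The listed elements include the identity and are closed under left multiplication by the
  generators in I, hence they exhaust the subgroup.\<close>

lemma generate_parabolic:
  assumes I: "I \<subseteq> letters" "I \<noteq> letters"
  shows "generate Gp (gen ` I) = parabolic I"
proof
  show "parabolic I \<subseteq> generate Gp (gen ` I)"
    using cls_rword_generate[OF _ I(1)] by (auto simp: parabolic_def)
  have par_closed: "parabolic I \<subseteq> carrier Gp"
    using I(1) by (auto simp: parabolic_def intro!: cls_closed)
  have one: "\<one>\<^bsub>Gp\<^esub> \<in> parabolic I"
    by (auto simp: parabolic_def parabolic_words_def rword_def simp flip: cls_Nil intro!: image_eqI[of _ _ "[]"])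
  have "x \<otimes>\<^bsub>Gp\<^esub> z \<in> parabolic I" if "x \<in> generate Gp (gen ` I)" "z \<in> parabolic I" for x z
    using that
  proof (induction arbitrary: z rule: generate.induct)
    case one
    then show ?case using par_closed by auto
  next
    case (incl x)
    then show ?case using parabolic_Cons[OF I] by auto
  next
    case (inv x)
    then show ?case using parabolic_Cons[OF I] I(1) inv_gen by auto
  next
    case (eng x y)
    have "x \<in> carrier Gp" "y \<in> carrier Gp"
      using eng.hyps generate_closed[OF I(1)] by auto
    then show ?case using eng par_closed by (auto simp: Gp.m_assoc)
  qed
  note mult = this
  show "generate Gp (gen ` I) \<subseteq> parabolic I"
  proof
    fix x assume x: "x \<in> generate Gp (gen ` I)"
    then have "x \<in> carrier Gp" using generate_closed[OF I(1)] by blast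
    then show "x \<in> parabolic I" using mult[OF x one] by simp
  qed
qed

text \<open>An element has only one listed word, so if it lies in both sets the letters of that word
  lie in both I and J.\<close>

lemma parabolic_Int: "parabolic I \<inter> parabolic J = parabolic (I \<inter> J)"
proof -
  have "parabolic I \<inter> parabolic J = (\<lambda>u. cls (rword u)) `
    ({u \<in> set parabolic_words. set u \<subseteq> I} \<inter> {u \<in> set parabolic_words. set u \<subseteq> J})"
    unfolding parabolic_def by (rule inj_on_image_Int[OF inj_cls_parabolic, symmetric]) auto
  also have "\<dots> = parabolic (I \<inter> J)" unfolding parabolic_def by (rule arg_cong2[where f = image]) auto
  finally show ?thesis .
qed

lemma generate_letters: "generate Gp (gen ` letters) = carrier Gp"
proof
  show "generate Gp (gen ` letters) \<subseteq> carrier Gp"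
    by (rule generate_closed) simp
  have "cls w \<in> generate Gp (gen ` letters)" if "w \<in> words letters" for w
    using that
  proof (induction w)
    case Nil
    then show ?case by (simp add: cls_Nil generate.one)
  next
    case (Cons x w)
    obtain i s where x: "x = (i, s)" by (cases x)
    then have "i \<in> letters" "w \<in> words letters" using Cons.prems by simp_all
    moreover from this have "cls (x # w) = gen i \<otimes>\<^bsub>Gp\<^esub> cls w"
      using cls_append[of "[(i, s)]" w] cls_letter[of i s] by (auto simp: gen_def x)
    moreover have "gen i \<in> generate Gp (gen ` letters)"
      using \<open>i \<in> letters\<close> by (intro generate.incl imageI)
    ultimately show ?case using Cons.IH by (simp add: generate.eng)
  qed
  then show "carrier Gp \<subseteq> generate Gp (gen ` letters)" by (auto simp: carrier_Gp)
qed

lemma cls_rword_neq: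
  assumes "u \<in> set parabolic_words" "v \<in> set parabolic_words" "u \<noteq> v"
  shows "cls (rword u) \<noteq> cls (rword v)"
  using inj_cls_parabolic assms by (auto dest: inj_onD)

lemma string_C: "string_C_group3 Gp gen"
proof -
  have "Gp.ord (gen i) = 2" if "i \<in> letters" for i
  proof -
    have "gen i \<noteq> \<one>\<^bsub>Gp\<^esub>"
      using cls_rword_neq[of "[i]" "[]"] that by (auto simp: gen_def rword_def cls_Nil parabolic_words_def)
    then have "Gp.ord (gen i) \<noteq> 1"
      using Gp.ord_eq_1[OF gen_closed[OF that]] by simp
    moreover have "Gp.ord (gen i) dvd 2"
      using Gp.pow_eq_id[OF gen_closed[OF that], of 2] gen_sq[OF that] gen_closed[OF that]
      by (simp add: numeral_2_eq_2)
    moreover from this have "Gp.ord (gen i) \<le> 2" "Gp.ord (gen i) \<noteq> 0"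
      using dvd_imp_le[of "Gp.ord (gen i)" 2] by (auto intro: Nat.gr0I)
    ultimately show ?thesis by linarith
  qed
  moreover have "generate Gp (gen ` I) \<inter> generate Gp (gen ` J) = generate Gp (gen ` (I \<inter> J))"
    if IJ: "I \<subseteq> letters" "J \<subseteq> letters" for I J
  proof -
    consider "I = letters" | "J = letters" | "I \<noteq> letters" "J \<noteq> letters" by blast
    then show ?thesis
    proof cases
      case 1
      then show ?thesis using generate_closed[OF IJ(2)] IJ(2) by (simp add: generate_letters Int_absorb1)
    next
      case 2
      then show ?thesis using generate_closed[OF IJ(1)] IJ(1) by (simp add: generate_letters Int_absorb2)
    next
      case 3
      then have "I \<inter> J \<noteq> letters" using IJ by blast
      then show ?thesis
        using 3 IJ by (simp add: generate_parabolic parabolic_Int le_infI1)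
    qed
  qed
  ultimately show ?thesis
    using generate_letters gen_closed ac Gp.is_group
    unfolding string_C_group3_def by (auto simp: letters_def gen_def)
qed

text \<open>The listed words for the square and the cube of x differ from the identity, so the order
  divides 6 but neither 2 nor 3.\<close>

lemma ord_6:
  assumes "[i, j, i, j] \<in> set parabolic_words" "[i, j, i, j, i, j] \<in> set parabolic_words"
    and x: "x = cls (rword [i, j])" "x [^]\<^bsub>Gp\<^esub> (6::nat) = \<one>\<^bsub>Gp\<^esub>"
  shows "Gp.ord x = 6"
proof -
  have ij: "i \<in> letters" "j \<in> letters"
    using parabolic_words_letters[OF assms(1)] by simp_all
  then have xc: "x \<in> carrier Gp" by (simp add: x cls_closed)
  have e: "rword [i, j] \<up> 2 = rword [i, j, i, j]" "rword [i, j] \<up> 3 = rword [i, j, i, j, i, j]"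
    by (simp_all add: wpow_numeral rword_def)
  have "x [^]\<^bsub>Gp\<^esub> (2::nat) \<noteq> \<one>\<^bsub>Gp\<^esub>" "x [^]\<^bsub>Gp\<^esub> (3::nat) \<noteq> \<one>\<^bsub>Gp\<^esub>"
    using cls_rword_neq[OF assms(1), of "[]"] cls_rword_neq[OF assms(2), of "[]"] ij
      cls_wpow[of "rword [i, j]" 2] cls_wpow[of "rword [i, j]" 3]
    by (simp_all add: x e cls_Nil parabolic_words_def) (simp_all add: rword_def cls_Nil)
  then have d: "\<not> Gp.ord x dvd 2" "\<not> Gp.ord x dvd 3" "Gp.ord x dvd 6"
    using Gp.pow_eq_id[OF xc] x(2) by simp_all
  from d(3) have "Gp.ord x \<le> 6"
    by (rule dvd_imp_le) simp
  then consider "Gp.ord x = 0" | "Gp.ord x = 1" | "Gp.ord x = 2" | "Gp.ord x = 3"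
    | "Gp.ord x = 4" | "Gp.ord x = 5" | "Gp.ord x = 6" by linarith
  then show ?thesis using d by cases simp_all
qed

lemma type_66: "schlafli_type Gp gen = (6, 6)"
proof -
  have "Gp.ord (gen 0 \<otimes>\<^bsub>Gp\<^esub> gen 1) = 6"
    by (rule ord_6[of 0 1])
      (use ab6 cls_append[of r0 r1] in \<open>simp_all add: parabolic_words_def dih_def gen_def rword_def\<close>)
  moreover have "Gp.ord (gen 1 \<otimes>\<^bsub>Gp\<^esub> gen 2) = 6"
    by (rule ord_6[of 1 2])
      (use bc6 cls_append[of r1 r2] in \<open>simp_all add: parabolic_words_def dih_def gen_def rword_def\<close>)
  ultimately show ?thesis by (simp add: schlafli_type_def)
qed

end

section \<open>Solvability\<close>

text \<open>Letting \<open>b\<close> act as \<open>x \<mapsto> 1 - x\<close> and \<open>a, c\<close> as \<open>x \<mapsto> - x\<close>, \<open>turn w\<close> is the image of 0. Modulo 3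
  this is the action on the three pairings of the residues modulo 4, so it is additive on words of even
  length and singles out the Klein four-group.\<close>

primrec turn :: "nat word \<Rightarrow> int" where
  "turn [] = 0"
| "turn (x # w) = (if fst x = 1 then 1 else 0) - turn w"

primrec balanced :: "nat word \<Rightarrow> bool" where
  "balanced [] = True"
| "balanced (x # w) = (if fst x = 1 then \<not> balanced w else balanced w)"

lemma turn_append: "turn (u @ v) = turn u + (if even (length u) then turn v else - turn v)"
  by (induction u) auto

lemma turn_winv: "turn (winv w) = (if even (length w) then - turn w else turn w)"
  by (induction w) (auto simp: winv_def turn_append)

lemma length_winv [simp]: "length (winv w) = length w"
  by (simp add: winv_def)

lemma balanced_append: "balanced (u @ v) \<longleftrightarrow> balanced u = balanced v"
  by (induction u) auto

lemma balanced_winv: "balanced (winv w) = balanced w"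
  by (induction w) (auto simp: winv_def balanced_append)

lemma winv_append: "winv (u @ v) = winv v @ winv u"
  by (simp add: winv_def)

lemma act_balanced: "act w (x + 4 * n) = act w x + (if balanced w then 4 * n else - 4 * n)"
proof (induction w)
  case (Cons y w)
  obtain i s where y: "y = (i, s)" by (cases y)
  show ?case
    using letter_act_periodic[of i "act w x" n] letter_act_periodic[of i "act w x" "- n"]
    by (auto simp: y Cons)
qed simp

text \<open>The orbit of the state of the empty word under the three letters: each of the 24
  permutations of the residues 0, 1, 2, 3 with its parity and its \<open>turn\<close> modulo 3. The
  entries beginning with True, 0 form the Klein four-group.\<close>

definition residue_states :: "(bool \<times> int \<times> int \<times> int \<times> int \<times> int) set" where
  "residue_states =
    {(False, 0, 0, 2, 1, 3), (False, 0, 1, 3, 0, 2), (False, 0, 2, 0, 3, 1), (False, 0, 3, 1, 2, 0),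
     (False, 1, 0, 3, 2, 1), (False, 1, 1, 2, 3, 0), (False, 1, 2, 1, 0, 3), (False, 1, 3, 0, 1, 2),
     (False, 2, 0, 1, 3, 2), (False, 2, 1, 0, 2, 3), (False, 2, 2, 3, 1, 0), (False, 2, 3, 2, 0, 1),
     (True, 0, 0, 1, 2, 3), (True, 0, 1, 0, 3, 2), (True, 0, 2, 3, 0, 1), (True, 0, 3, 2, 1, 0),
     (True, 1, 0, 2, 3, 1), (True, 1, 1, 3, 2, 0), (True, 1, 2, 0, 1, 3), (True, 1, 3, 1, 0, 2),
     (True, 2, 0, 3, 1, 2), (True, 2, 1, 2, 0, 3), (True, 2, 2, 1, 3, 0), (True, 2, 3, 0, 2, 1)}"

definition residue_state :: "nat word \<Rightarrow> bool \<times> int \<times> int \<times> int \<times> int \<times> int" where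
  "residue_state w = (even (length w), turn w mod 3, act w 0 mod 4, act w 1 mod 4, act w 2 mod 4, act w 3 mod 4)"

lemma letter_act_mod_4: "letter_act i x mod 4 = letter_act i (x mod 4) mod 4"
proof -
  have "letter_act i x = letter_act i (x mod 4 + 4 * (x div 4))" by simp
  then show ?thesis unfolding letter_act_periodic by simp
qed

definition step_state :: "nat \<Rightarrow> bool \<times> int \<times> int \<times> int \<times> int \<times> int \<Rightarrow> bool \<times> int \<times> int \<times> int \<times> int \<times> int" where
  "step_state i = (\<lambda>(e, t, p, q, r, s). (\<not> e, ((if i = 1 then 1 else 0) - t) mod 3,
     letter_act i p mod 4, letter_act i q mod 4, letter_act i r mod 4, letter_act i s mod 4))"

lemma residue_state_Cons: "residue_state ((i, s) # w) = step_state i (residue_state w)"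
  by (simp add: residue_state_def step_state_def letter_act_mod_4[symmetric] mod_diff_right_eq)

lemma step_states: "i \<in> letters \<Longrightarrow> z \<in> residue_states \<Longrightarrow> step_state i z \<in> residue_states"
proof -
  have "\<forall>i\<in>{0,1,2}. \<forall>z\<in>residue_states. step_state i z \<in> residue_states"
    by code_simp
  then show "i \<in> letters \<Longrightarrow> z \<in> residue_states \<Longrightarrow> step_state i z \<in> residue_states"
    unfolding letters_def by blast
qed

lemma residue_state_mem: "w \<in> words letters \<Longrightarrow> residue_state w \<in> residue_states"
proof (induction w)
  case (Cons x w)
  obtain i s where "x = (i, s)" by (cases x)
  then show ?case
    using Cons step_states[of i "residue_state w"] by (simp add: residue_state_Cons)
qed (simp add: residue_state_def residue_states_def)

definition klein :: "nat word \<Rightarrow> bool" where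
  "klein w \<longleftrightarrow> even (length w) \<and> balanced w \<and> 3 dvd turn w"

text \<open>The Klein four-group on residues modulo 4 consists of affine maps: the translations by 0
  and 2 and the reflections 1 - x and 3 - x. This form reduces commutation to a congruence.\<close>

lemma klein_residues:
  assumes "w \<in> words letters" "klein w"
  shows "\<exists>s c. (s, c) \<in> {(1, 0), (-1, 1), (1, 2), (-1, 3)} \<and> (\<forall>x. act w x mod 4 = (s * x + c) mod 4)"
proof -
  have b: "balanced w" using assms(2) by (simp add: klein_def)
  have "residue_state w \<in> residue_states" using residue_state_mem[OF assms(1)] .
  moreover have "fst (residue_state w)" "fst (snd (residue_state w)) = 0"
    using assms(2) by (auto simp: residue_state_def klein_def)
  ultimately have "snd (snd (residue_state w)) \<in> {(0, 1, 2, 3), (1, 0, 3, 2), (2, 3, 0, 1), (3, 2, 1, 0)}"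
    unfolding residue_states_def by auto
  also have "\<dots> = (\<lambda>(s, c). (c mod 4, (s + c) mod 4, (s * 2 + c) mod 4, (s * 3 + c) mod 4)) `
      {(1, 0), (-1, 1), (1, 2), (-1, 3)}"
    by simp
  finally obtain z where z: "z \<in> {(1, 0), (-1, 1), (1, 2), (-1, 3)}"
    "snd (snd (residue_state w)) =
      (\<lambda>(s, c). (c mod 4, (s + c) mod 4, (s * 2 + c) mod 4, (s * 3 + c) mod 4)) z"
    by (rule imageE)
  obtain s c where sz: "z = (s, c)" by (cases z)
  have sc: "(s, c) \<in> {(1, 0), (-1, 1), (1, 2), (-1, 3)}"
    using z(1) unfolding sz .
  have "snd (snd (residue_state w)) = (c mod 4, (s + c) mod 4, (s * 2 + c) mod 4, (s * 3 + c) mod 4)"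
    using z(2) by (simp only: sz prod.case)
  then have vals: "act w 0 mod 4 = c mod 4" "act w 1 mod 4 = (s + c) mod 4"
    "act w 2 mod 4 = (s * 2 + c) mod 4" "act w 3 mod 4 = (s * 3 + c) mod 4"
    by (simp_all add: residue_state_def)
  have "act w x mod 4 = (s * x + c) mod 4" for x
  proof -
    have "act w x mod 4 = act w (x mod 4) mod 4"
      using act_balanced[of w "x mod 4" "x div 4"] b by simp
    also have "\<dots> = (s * (x mod 4) + c) mod 4"
      using residues_4[of x] by (elim disjE; simp only: vals mult_zero_right add_0 mult_1_right)
    also have "\<dots> = (s * x + c) mod 4"
      by (metis mod_add_left_eq mod_mult_right_eq)
    finally show ?thesis .
  qed
  then show ?thesis using sc by blast
qed

definition residual :: "nat word \<Rightarrow> bool" where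
  "residual w \<longleftrightarrow> balanced w \<and> (\<forall>x. act w x mod 4 = x mod 4)"

lemma klein_commutator:
  assumes "u \<in> words letters" "v \<in> words letters" "klein u" "klein v"
  shows "residual (u @ v @ winv u @ winv v)"
proof -
  obtain s c where sc: "(s, c) \<in> {(1, 0), (-1, 1), (1, 2), (-1, 3)}" "\<And>x. act u x mod 4 = (s * x + c) mod 4"
    using klein_residues assms(1,3) by metis
  obtain t d where td: "(t, d) \<in> {(1, 0), (-1, 1), (1, 2), (-1, 3)}" "\<And>x. act v x mod 4 = (t * x + d) mod 4"
    using klein_residues assms(2,4) by metis
  have "act u (act v y) mod 4 = act v (act u y) mod 4" for y
  proof -
    have "act u (act v y) mod 4 = (s * (t * y + d) + c) mod 4"
      by (metis sc(2) td(2) mod_add_left_eq mod_mult_right_eq)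
    also have "\<dots> = (t * (s * y + c) + d) mod 4"
      using sc(1) td(1) by (auto simp: algebra_simps mod_eq_dvd_iff)
    also have "\<dots> = act v (act u y) mod 4"
      by (metis sc(2) td(2) mod_add_left_eq mod_mult_right_eq)
    finally show ?thesis .
  qed
  \<comment> \<open>Choosing y as the image of x under the inverse of vu turns commutation into a
    statement about the commutator.\<close>
  from this[of "act (winv (v @ u)) _"]
  have "act (u @ v @ winv u @ winv v) x mod 4 = x mod 4" for x
    by (simp add: winv_append act_winv)
  then show ?thesis
    by (auto simp: residual_def balanced_append balanced_winv)
qed

text \<open>Such words displace each residue class modulo 4 by a constant and preserve the class, so
  the displacements of u and v at x simply add up.\<close>

lemma residual_commute:
  assumes "residual u" "residual v"
  shows "act u (act v x) = act v (act u x)"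
proof -
  obtain m where m: "act v x = x + 4 * m"
    using assms(2) unfolding residual_def by (metis mod_eqE mult.commute)
  obtain n where n: "act u x = x + 4 * n"
    using assms(1) unfolding residual_def by (metis mod_eqE mult.commute)
  show ?thesis
    using assms act_balanced[of u x m] act_balanced[of v x n] by (simp add: m n residual_def)
qed

lemma residual_commutator:
  assumes "residual u" "residual v"
  shows "act (u @ v @ winv u @ winv v) = id"
proof
  fix x
  show "act (u @ v @ winv u @ winv v) x = id x"
    using residual_commute[OF assms, of "act (winv (v @ u)) x"] by (simp add: winv_append act_winv)
qed

lemma residual_winv: "residual w \<Longrightarrow> residual (winv w)"
  unfolding residual_def by (metis act_winv(2) balanced_winv)

section \<open>Derived subgroups described by properties of words\<close>

context extension_66_3
begin

lemma subgroup_cls: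
  assumes "P []" "\<And>u v. P u \<Longrightarrow> P v \<Longrightarrow> P (u @ v)" "\<And>u. P u \<Longrightarrow> P (winv u)"
  shows "subgroup (cls ` {w \<in> words letters. P w}) Gp"
proof
  show "cls ` {w \<in> words letters. P w} \<subseteq> carrier Gp" by (auto intro: cls_closed)
  show "\<one>\<^bsub>Gp\<^esub> \<in> cls ` {w \<in> words letters. P w}"
    using assms(1) by (auto simp flip: cls_Nil)
  fix x assume "x \<in> cls ` {w \<in> words letters. P w}"
  then obtain u where u: "u \<in> words letters" "P u" "x = cls u" by blast
  show "inv\<^bsub>Gp\<^esub> x \<in> cls ` {w \<in> words letters. P w}"
    using u assms(3) by (auto simp flip: cls_winv)
  fix y assume "y \<in> cls ` {w \<in> words letters. P w}"
  then obtain v where v: "v \<in> words letters" "P v" "y = cls v" by blast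
  show "x \<otimes>\<^bsub>Gp\<^esub> y \<in> cls ` {w \<in> words letters. P w}"
    using u v assms(2) by (auto simp flip: cls_append)
qed

lemma derived_cls:
  assumes "\<And>u v. u \<in> words letters \<Longrightarrow> v \<in> words letters \<Longrightarrow> P u \<Longrightarrow> P v \<Longrightarrow>
      cls (u @ v @ winv u @ winv v) \<in> K"
    and "subgroup K Gp" and "H \<subseteq> cls ` {w \<in> words letters. P w}"
  shows "derived Gp H \<subseteq> K"
  unfolding derived_def
proof (rule Gp.generate_subgroup_incl[OF _ assms(2)], safe)
  fix x y assume "x \<in> H" "y \<in> H"
  then obtain u v where uv: "u \<in> words letters" "P u" "x = cls u" "v \<in> words letters" "P v" "y = cls v"
    using assms(3) by blast
  have "x \<otimes>\<^bsub>Gp\<^esub> y \<otimes>\<^bsub>Gp\<^esub> inv\<^bsub>Gp\<^esub> x \<otimes>\<^bsub>Gp\<^esub> inv\<^bsub>Gp\<^esub> y = cls (u @ v @ winv u @ winv v)"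
    using uv by (simp add: cls_append cls_winv cls_closed Gp.m_assoc)
  then show "x \<otimes>\<^bsub>Gp\<^esub> y \<otimes>\<^bsub>Gp\<^esub> inv\<^bsub>Gp\<^esub> x \<otimes>\<^bsub>Gp\<^esub> inv\<^bsub>Gp\<^esub> y \<in> K"
    using assms(1) uv by simp
qed

end

context torus_66_3
begin

text \<open>Commutators are even and balanced; on even words \<open>turn\<close> is additive, so
  their commutators have \<open>turn\<close> 0. Klein words commute on residues, and residual words
  commute as maps, which faithfulness turns into equality in the group. The fourth derived subgroup
  is therefore trivial.\<close>

lemma solvable_Gp: "solvable Gp"
proof -
  define E where "E w \<longleftrightarrow> even (length w) \<and> balanced w" for w :: "nat word"
  have 1: "derived Gp (carrier Gp) \<subseteq> cls ` {w \<in> words letters. E w}"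
    by (rule derived_cls[where P = "\<lambda>_. True"])
      (auto simp: E_def carrier_Gp balanced_append balanced_winv intro!: imageI subgroup_cls)
  have 2: "derived Gp H \<subseteq> cls ` {w \<in> words letters. klein w}"
    if "H \<subseteq> cls ` {w \<in> words letters. E w}" for H
    by (rule derived_cls[OF _ _ that])
      (auto simp: E_def klein_def balanced_append balanced_winv turn_append turn_winv intro!: imageI subgroup_cls)
  have 3: "derived Gp H \<subseteq> cls ` {w \<in> words letters. residual w}"
    if "H \<subseteq> cls ` {w \<in> words letters. klein w}" for H
  proof (rule derived_cls[OF _ _ that])
    show "subgroup (cls ` {w \<in> words letters. residual w}) Gp"
      by (rule subgroup_cls) (auto simp: residual_winv, auto simp: residual_def balanced_append)
  qed (auto intro!: imageI klein_commutator)
  have 4: "derived Gp H \<subseteq> {\<one>\<^bsub>Gp\<^esub>}"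
    if "H \<subseteq> cls ` {w \<in> words letters. residual w}" for H
  proof (rule derived_cls[OF _ Gp.triv_subgroup that])
    fix u v assume *: "u \<in> words letters" "v \<in> words letters" "residual u" "residual v"
    have "cls (u @ v @ winv u @ winv v) = cls []"
      using * residual_commutator[OF *(3,4)] by (intro act_eq_imp_cls_eq) simp_all
    then show "cls (u @ v @ winv u @ winv v) \<in> {\<one>\<^bsub>Gp\<^esub>}" by (simp add: cls_Nil)
  qed
  have "(derived Gp ^^ 4) (carrier Gp) \<subseteq> {\<one>\<^bsub>Gp\<^esub>}"
    using 4[OF 3[OF 2[OF 1]]] by (simp add: eval_nat_numeral One_nat_def)
  moreover have "\<one>\<^bsub>Gp\<^esub> \<in> (derived Gp ^^ 4) (carrier Gp)"
    using Gp.exp_of_derived_is_subgroup[OF Gp.subgroup_self] by (rule subgroup.one_closed)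
  ultimately show ?thesis
    unfolding Gp.solvable_iff_trivial_derived_seq by blast
qed

end

section \<open>The three families\<close>

lemma act_wconj: "act (wconj w g) = act (winv g) \<circ> act w \<circ> act g"
  by (simp add: wconj_def comp_assoc)

lemma act_wpow_mult: "act (w \<up> (n * m)) = act (w \<up> n) ^^ m"
  by (simp add: act_wpow funpow_mult mult.commute)

text \<open>Each added relator acts as the m-th power of its instance for m = 1, even after
  conjugation, so its action is computed once and then scaled.\<close>

lemma act_wconj_wpow_mult: "act (wconj (w \<up> (n * m)) g) = act (wconj (w \<up> n) g) ^^ m"
proof -
  have "(act (winv g) \<circ> f \<circ> act g) ^^ m = act (winv g) \<circ> f ^^ m \<circ> act g" for f
    by (induction m) (simp_all add: fun_eq_iff act_winv)
  then show ?thesis by (simp add: act_wconj act_wpow_mult)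
qed

definition in_lattice :: "int \<Rightarrow> int \<Rightarrow> int \<times> int \<times> int \<Rightarrow> bool" where
  "in_lattice k h = (\<lambda>(i, j, l). \<exists>t. k dvd i - h * t \<and> k dvd j - h * t \<and> k dvd l - h * t \<and> k dvd - i - j - l - h * t)"

lemma act_eq_shift:
  assumes "in_lattice k h (i, j, l)"
  shows "act_eq (m * k) (m * h) (shift (m * i) (m * j) (m * l)) id"
proof -
  obtain t where t: "k dvd i - h * t" "k dvd j - h * t" "k dvd l - h * t" "k dvd - i - j - l - h * t"
    using assms by (auto simp: in_lattice_def)
  have *: "4 * (m * k) dvd 4 * (m * (y - h * t))" if "k dvd y - h * t" for y
    using that by (intro mult_dvd_mono dvd_refl)
  have "4 * (m * k) dvd shift (m * i) (m * j) (m * l) x - id x - 4 * (m * h) * t" for x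
    using *[OF t(1)] *[OF t(2)] *[OF t(3)] *[OF t(4)] by (simp add: shift_def algebra_simps)
  then show ?thesis unfolding act_eq_def by blast
qed

lemma (in extension_66_3) tr_combination:
  assumes "tr i1 j1 l1 = \<one>\<^bsub>Gp\<^esub>" "tr i2 j2 l2 = \<one>\<^bsub>Gp\<^esub>" "tr i3 j3 l3 = \<one>\<^bsub>Gp\<^esub>"
  shows "tr (n1 * i1 + n2 * i2 + n3 * i3) (n1 * j1 + n2 * j2 + n3 * j3) (n1 * l1 + n2 * l2 + n3 * l3) = \<one>\<^bsub>Gp\<^esub>"
proof -
  have "tr i1 j1 l1 [^]\<^bsub>Gp\<^esub> n1 \<otimes>\<^bsub>Gp\<^esub> tr i2 j2 l2 [^]\<^bsub>Gp\<^esub> n2 \<otimes>\<^bsub>Gp\<^esub> tr i3 j3 l3 [^]\<^bsub>Gp\<^esub> n3 = \<one>\<^bsub>Gp\<^esub>"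
    unfolding assms by simp
  then show ?thesis by (simp add: tr_int_pow tr_mult)
qed

lemma (in torus_66_3) string_C_group_66:
  "string_C_group3 (presented_group {0,1,2} S) (pres_gen {0,1,2} S) \<and>
   schlafli_type (presented_group {0,1,2} S) (pres_gen {0,1,2} S) = (6, 6) \<and>
   solvable (presented_group {0,1,2} S) \<and> int (order (presented_group {0,1,2} S)) = 48 * h * k\<^sup>2"
proof -
  have "presented_group {0,1,2} S = Gp" "pres_gen {0,1,2} S = gen"
    by (simp_all add: Gp_def letters_def fun_eq_iff gen_def pres_gen_def cls_def)
  then show ?thesis using string_C type_66 solvable_Gp order_Gp by simp
qed

text \<open>Two lattices are shown equal. The assumptions \<open>lattice\<close> make the action
  respect the added relators; the coefficients in \<open>generate\<close> express the triangular
  basis through the relator vectors, so that the basis becomes trivial in the group.\<close>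

lemma torus_66_3I:
  assumes S: "S = rels \<union> {q1, q2, q3}" and m: "0 < m"
    and words: "q1 \<in> words letters" "q2 \<in> words letters" "q3 \<in> words letters"
    and act: "act q1 = shift (m * i1) (m * j1) (m * l1)" "act q2 = shift (m * i2) (m * j2) (m * l2)"
      "act q3 = shift (m * i3) (m * j3) (m * l3)"
    and lattice: "in_lattice k h (i1, j1, l1)" "in_lattice k h (i2, j2, l2)" "in_lattice k h (i3, j3, l3)"
    and kh: "0 < k" "0 < h" "h dvd k" "2 dvd k" "k dvd 4 * h"
    and generate: "x * i1 + y * i2 + z * i3 = h" "x * j1 + y * j2 + z * j3 = h" "x * l1 + y * l2 + z * l3 = h"
      "x' * i1 + y' * i2 + z' * i3 = 0" "x' * j1 + y' * j2 + z' * j3 = k" "x' * l1 + y' * l2 + z' * l3 = 0"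
      "x'' * i1 + y'' * i2 + z'' * i3 = 0" "x'' * j1 + y'' * j2 + z'' * j3 = 0" "x'' * l1 + y'' * l2 + z'' * l3 = k"
  shows "torus_66_3 S (m * k) (m * h)"
proof -
  interpret extension_66_3 S
    by unfold_locales (auto simp: S)
  have tr: "tr (m * i1) (m * j1) (m * l1) = \<one>\<^bsub>Gp\<^esub>" "tr (m * i2) (m * j2) (m * l2) = \<one>\<^bsub>Gp\<^esub>"
    "tr (m * i3) (m * j3) (m * l3) = \<one>\<^bsub>Gp\<^esub>"
    using cls_relator[OF _ words(1)] cls_relator[OF _ words(2)] cls_relator[OF _ words(3)]
      cls_translation[OF words(1) act(1)] cls_translation[OF words(2) act(2)]
      cls_translation[OF words(3) act(3)] by (simp_all add: S)
  have comb: "tr (m * (x * i1 + y * i2 + z * i3)) (m * (x * j1 + y * j2 + z * j3)) (m * (x * l1 + y * l2 + z * l3)) = \<one>\<^bsub>Gp\<^esub>"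
    for x y z
    using tr_combination[OF tr, of x y z] by (simp add: algebra_simps)
  show ?thesis
  proof unfold_locales
    show "0 < m * k" "0 < m * h" "m * h dvd m * k" "2 dvd m * k" "m * k dvd 4 * (m * h)"
      using m kh by (auto intro: mult_dvd_mono simp: mult.left_commute[of 4 m])
    show "act_eq (m * k) (m * h) (act s) id" if "s \<in> S" for s
      using that act_rels act_eq_shift[OF lattice(1), of m] act_eq_shift[OF lattice(2), of m]
        act_eq_shift[OF lattice(3), of m] by (auto simp: S act)
    show "tr (m * h) (m * h) (m * h) = \<one>\<^bsub>Gp\<^esub>" "tr 0 (m * k) 0 = \<one>\<^bsub>Gp\<^esub>" "tr 0 0 (m * k) = \<one>\<^bsub>Gp\<^esub>"
      using comb[of x y z] comb[of x' y' z'] comb[of x'' y'' z''] by (simp_all add: generate)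
  qed
qed

text \<open>The instances for m = 1 are settled by five values each. The products with 1 and -1 stay
  unsimplified to match the form expected by \<open>torus_66_3I\<close>.\<close>

lemma act_relators_1:
  "act (wconj ((r0 @ r2 @ r1) \<up> (4 * m)) r1) = shift (int m * 1) (int m * -1) (int m * 1)"
  "act ((r2 @ r1 @ r0) \<up> (4 * m)) = shift (int m * 1) (int m * -1) (int m * -1)"
  "act (wconj ((r2 @ r1 @ r0) \<up> (4 * m)) r1) = shift (int m * -1) (int m * -1) (int m * 1)"
proof -
  have "act (wconj ((r0 @ r2 @ r1) \<up> 4) r1) = shift 1 (-1) 1" "act ((r2 @ r1 @ r0) \<up> 4) = shift 1 (-1) (-1)"
    "act (wconj ((r2 @ r1 @ r0) \<up> 4) r1) = shift (-1) (-1) 1"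
    by (rule act_eqI; simp add: wconj_def winv_def wpow_numeral letter_act_def shift_def)+
  then show "act (wconj ((r0 @ r2 @ r1) \<up> (4 * m)) r1) = shift (int m * 1) (int m * -1) (int m * 1)"
    "act ((r2 @ r1 @ r0) \<up> (4 * m)) = shift (int m * 1) (int m * -1) (int m * -1)"
    "act (wconj ((r2 @ r1 @ r0) \<up> (4 * m)) r1) = shift (int m * -1) (int m * -1) (int m * 1)"
    by (simp_all only: act_wconj_wpow_mult act_wpow_mult shift_pow)
qed

lemma act_relators_2:
  defines "w \<equiv> (r1 @ r2) \<up> 3 @ (r0 @ r1) \<up> 3"
  shows "act (wconj (w \<up> (2 * m)) (r0 @ r1)) = shift (int m * 2) (int m * -2) (int m * 0)"
    "act (wconj (w \<up> (2 * m)) r2) = shift (int m * 0) (int m * -2) (int m * 2)"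
    "act (wconj (w \<up> (2 * m)) (r2 @ r1)) = shift (int m * 0) (int m * 0) (int m * -2)"
proof -
  have "act (wconj (w \<up> 2) (r0 @ r1)) = shift 2 (-2) 0" "act (wconj (w \<up> 2) r2) = shift 0 (-2) 2"
    "act (wconj (w \<up> 2) (r2 @ r1)) = shift 0 0 (-2)"
    unfolding w_def
    by (rule act_eqI; simp add: wconj_def winv_def wpow_numeral letter_act_def shift_def)+
  then show "act (wconj (w \<up> (2 * m)) (r0 @ r1)) = shift (int m * 2) (int m * -2) (int m * 0)"
    "act (wconj (w \<up> (2 * m)) r2) = shift (int m * 0) (int m * -2) (int m * 2)"
    "act (wconj (w \<up> (2 * m)) (r2 @ r1)) = shift (int m * 0) (int m * 0) (int m * -2)"
    by (simp_all only: act_wconj_wpow_mult shift_pow)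
qed

lemma act_relators_3:
  "act (wconj (((r0 @ r1) \<up> 2 @ (r2 @ r1) \<up> 2) \<up> (3 * m)) r0) = shift (int m * 3) (int m * -1) (int m * -1)"
  "act (((r1 @ r2) \<up> 2 @ (r1 @ r0) \<up> 2) \<up> (3 * m)) = shift (int m * 1) (int m * -3) (int m * 1)"
  "act (wconj (((r1 @ r0) \<up> 2 @ (r1 @ r2) \<up> 2) \<up> (3 * m)) r2) = shift (int m * 1) (int m * 1) (int m * -3)"
proof -
  have "act (wconj (((r0 @ r1) \<up> 2 @ (r2 @ r1) \<up> 2) \<up> 3) r0) = shift 3 (-1) (-1)"
    "act (((r1 @ r2) \<up> 2 @ (r1 @ r0) \<up> 2) \<up> 3) = shift 1 (-3) 1"
    "act (wconj (((r1 @ r0) \<up> 2 @ (r1 @ r2) \<up> 2) \<up> 3) r2) = shift 1 1 (-3)"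
    by (rule act_eqI; simp add: wconj_def winv_def wpow_numeral letter_act_def shift_def)+
  then show "act (wconj (((r0 @ r1) \<up> 2 @ (r2 @ r1) \<up> 2) \<up> (3 * m)) r0) = shift (int m * 3) (int m * -1) (int m * -1)"
    "act (((r1 @ r2) \<up> 2 @ (r1 @ r0) \<up> 2) \<up> (3 * m)) = shift (int m * 1) (int m * -3) (int m * 1)"
    "act (wconj (((r1 @ r0) \<up> 2 @ (r1 @ r2) \<up> 2) \<up> (3 * m)) r2) = shift (int m * 1) (int m * 1) (int m * -3)"
    by (simp_all only: act_wconj_wpow_mult act_wpow_mult shift_pow)
qed

lemma words_wconj [simp]: "u \<in> words X \<Longrightarrow> v \<in> words X \<Longrightarrow> wconj u v \<in> words X"
  by (simp add: wconj_def)

text \<open>For m = 1 all four coordinates of each relator vector are odd, whence k = 2, h = 1 and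
  the witness 1. The coefficients solve the linear equations for the triangular basis.\<close>

lemma torus_G: "1 \<le> m \<Longrightarrow> torus_66_3 (rels \<union> rels1 m) (int m * 2) (int m * 1)"
  by (rule torus_66_3I[OF arg_cong2[where f = "(\<union>)", OF HOL.refl rels1_def] _ _ _ _ act_relators_1,
      where x = 1 and y = "-1" and z = "-1" and x' = 0 and y' = "-1" and z' = "-1"
        and x'' = 1 and y'' = "-1" and z'' = 0])
    (auto simp: in_lattice_def intro: exI[of _ 1])

text \<open>Here the lattice for m = 1 consists of all even vectors of sum zero, so the witness is
  0.\<close>

lemma torus_H: "1 \<le> m \<Longrightarrow> torus_66_3 (rels \<union> rels2 m) (int m * 2) (int m * 2)"
  by (rule torus_66_3I[OF arg_cong2[where f = "(\<union>)", OF HOL.refl rels2_def] _ _ _ _ act_relators_2,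
      where x = 1 and y = "-2" and z = "-3" and x' = 0 and y' = "-1" and z' = "-1"
        and x'' = 0 and y'' = 0 and z'' = "-1"])
    (auto simp: in_lattice_def intro: exI[of _ 0])

text \<open>For m = 1 the four coordinates of a relator vector agree modulo 4: they are -1 for the
  first vector and 1 for the other two, which accounts for the two witnesses.\<close>

lemma torus_I: "1 \<le> m \<Longrightarrow> torus_66_3 (rels \<union> rels3 m) (int m * 4) (int m * 1)"
  by (rule torus_66_3I[OF arg_cong2[where f = "(\<union>)", OF HOL.refl rels3_def] _ _ _ _ act_relators_3,
      where x = 1 and y = "-1" and z = "-1" and x' = 1 and y' = "-2" and z' = "-1"
        and x'' = 1 and y'' = "-1" and z'' = "-2"])
    (auto simp: in_lattice_def intro: exI[of _ "-1"] exI[of _ 1])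

theorem theorem5p1:
  fixes m :: nat
  assumes "m \<ge> 1"
  shows "(string_C_group3 (grpG m) (genG m) \<and> schlafli_type (grpG m) (genG m) = (6, 6) \<and>
          solvable (grpG m) \<and> order (grpG m) = 192 * m ^ 3) \<and>
         (string_C_group3 (grpH m) (genH m) \<and> schlafli_type (grpH m) (genH m) = (6, 6) \<and>
          solvable (grpH m) \<and> order (grpH m) = 384 * m ^ 3) \<and>
         (string_C_group3 (grpI m) (genI m) \<and> schlafli_type (grpI m) (genI m) = (6, 6) \<and>
          solvable (grpI m) \<and> order (grpI m) = 768 * m ^ 3)"
proof -
  have order: "n = c * m ^ 3" if "int n = 48 * (int m * h) * (int m * k)\<^sup>2" "48 * h * k\<^sup>2 = int c" for n c h k
  proof -
    have "int n = (48 * h * k\<^sup>2) * int m ^ 3"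
      using that(1) by (simp add: power2_eq_square power3_eq_cube)
    also have "\<dots> = int (c * m ^ 3)"
      by (simp add: that(2))
    finally show ?thesis by (simp only: of_nat_eq_iff)
  qed
  show ?thesis
    using torus_66_3.string_C_group_66[OF torus_G[OF assms]] order[of _ 1 2 192]
      torus_66_3.string_C_group_66[OF torus_H[OF assms]] order[of _ 2 2 384]
      torus_66_3.string_C_group_66[OF torus_I[OF assms]] order[of _ 1 4 768]
    unfolding grpG_def genG_def grpH_def genH_def grpI_def genI_def by simp
qed

end
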